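(* There exists a large constant $R_1=R_1(M)>2M$ such that for any spherically symmetric solution $\phi$ to $\Box_g\phi=0$ on $\mathcal R$ whose initial data satisfy the data bounds with constant $D>0$ and the limit condition, the following holds. Assume that, in the exterior, $$\sup_{\{r=R_1\}\cap\{u\ge1\}}u^3|\phi|\le A'$$ for some $A'>0$, and assume moreover that $\mathfrak L\neq0$. Then there exist $R=R(\mathfrak L,A',D,U_0,R_1)>R_1$ and $U=U(\mathfrak L,A',D,U_0,\partial_v(r\phi)\restriction_{C_{-U_0}})$ sufficiently large such that on the curve $\{r=R\}$, for $u\ge U$, $$|\partial_v(r\phi)|(u,v)\restriction_{r=R}\ \ge\ \frac{|\mathfrak L|}{8}v^{-3}.$$
   Context: Fix $0<|e|<M$, let $r_\pm=M\pm\sqrt{M^2-e^2}$, $F(r)=1-\frac{2M}{r}+\frac{e^2}{r^2}$. On the exterior region $\{r>r_+\}$ and on the black hole interior $\{r_-<r<r_+\}$ the Reissner–Nordström metric is $g=-F\,dt^2+F^{-1}dr^2+r^2d\sigma_{\mathbb S^2}$. Put $r^*=r+\big(M+\frac{2M^2-e^2}{2\sqrt{M^2-e^2}}\big)\log|r-r_+|+\big(M-\frac{2M^2-e^2}{2\sqrt{M^2-e^2}}\big)\log|r-r_-|$. Exterior null coordinates: $v=\frac12(t+r^* )$, $u=\frac12(t-r^* )$, $\Omega^2=F$, $\partial_v r=-\partial_u r=\Omega^2$; future null infinity is $\{v=\infty\}$, the event horizon $\mathcal H^+$ is $\{u=+\infty\}$. Interior null coordinates: $v=\frac12(r^*+t)$,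 $u=\frac12(r^*-t)$, $\Omega^2=-F$, $\partial_v r=\partial_u r=-\Omega^2$; $\mathcal H^+$ is $\{u=-\infty\}$. In both regions $g=-4\Omega^2du\,dv+r^2d\sigma_{\mathbb S^2}$. The two regions are glued smoothly along $\mathcal H^+=\{r=r_+\}$ using coordinates $(v,r)$, in which $g=-4F\,dv^2+4\,dv\,dr+r^2d\sigma_{\mathbb S^2}$. For spherically symmetric $\phi$, $\Box_g\phi=0$ reads $\partial_u\partial_v\phi=-\frac{\partial_v r\,\partial_u\phi}{r}-\frac{\partial_u r\,\partial_v\phi}{r}$. Solutions are real-valued, $C^1$ (including across $\mathcal H^+$), with continuous $\partial_u\partial_v\phi$. Fix $U_0>0$. $\mathcal R$ is the union of the exterior set $\{u\ge -U_0,\ v\ge1\}$, $\mathcal H^+\cap\{v\ge1\}$, and the interior set $\{u\le-1,\ v\ge1\}$. $C_{-U_0}=\{u=-U_0,\ v\ge1\}$ in the exterior. Data bounds with constant $D$: on $C_{-U_0}$, $r^2\big|\frac{\partial_v\phi}{\partial_v r}\big|\le D$ and $r^3\big|\frac{\partial_v(r\phi)}{\partial_v r}\big|\le D$; on the hypersurface $\{v=1\}$, restricted to $u\ge -U_0$ in the exterior and $u\le -1$ in the interior, $\big|\frac{\partial_u\phi}{\partial_u r}\big|\le D$ and $\big|\frac{\partial_u(r\phi)}{\partial_u r}\big|\le D$. Limit condition: $\lim_{v\to\infty}r^3\partial_v(r\phi)(-U_0,v)$ exists. $\mathfrak L:=\lim_{v\to\infty} r^3\partial_v(r\phi)(-U_0,v)-\int_{-U_0}^\infty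 2M\Phi(u)\,du$ with $\Phi(u):=\lim_{v\to\infty}r\phi(u,v)$ (exterior; this limit exists for every spherically symmetric solution $\phi$ to $\Box_g\phi=0$ on $\mathcal R$ satisfying the data bounds with some constant $D>0$ and the limit condition). *)

theory Defs
  imports "HOL-Analysis.Analysis"
begin

text \<open>
  Spherically symmetric functions on the union of the exterior, the event horizon and the interior
  are functions of the coordinates \<open>(v, r)\<close>, which cover all three pieces; the null coordinates
  \<open>(u, v)\<close> cover the exterior and the interior separately.
\<close>

definition r_plus :: "real \<Rightarrow> real \<Rightarrow> real" where
  "r_plus M e = M + sqrt (M\<^sup>2 - e\<^sup>2)"

definition r_minus :: "real \<Rightarrow> real \<Rightarrow> real" where
  "r_minus M e = M - sqrt (M\<^sup>2 - e\<^sup>2)"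

definition r_star :: "real \<Rightarrow> real \<Rightarrow> real \<Rightarrow> real" where
  "r_star M e r = r
     + (M + (2 * M\<^sup>2 - e\<^sup>2) / (2 * sqrt (M\<^sup>2 - e\<^sup>2))) * ln \<bar>r - r_plus M e\<bar>
     + (M - (2 * M\<^sup>2 - e\<^sup>2) / (2 * sqrt (M\<^sup>2 - e\<^sup>2))) * ln \<bar>r - r_minus M e\<bar>"

text \<open>
  The area radius as a function of the null coordinates. For \<open>0 < \<bar>e\<bar> < M\<close> the function \<open>r\<^sup>*\<close> maps
  each of \<open>(r\<^sub>+, \<infinity>)\<close> and \<open>(r\<^sub>-, r\<^sub>+)\<close> bijectively onto the real line, \<open>r\<^sup>* = v - u\<close> in the
  exterior and \<open>r\<^sup>* = v + u\<close> in the interior.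
\<close>

definition r_ext :: "real \<Rightarrow> real \<Rightarrow> real \<Rightarrow> real \<Rightarrow> real" where
  "r_ext M e u v = inv_into {r_plus M e<..} (r_star M e) (v - u)"

definition r_int :: "real \<Rightarrow> real \<Rightarrow> real \<Rightarrow> real \<Rightarrow> real" where
  "r_int M e u v = inv_into {r_minus M e<..<r_plus M e} (r_star M e) (v + u)"

definition region :: "real \<Rightarrow> real \<Rightarrow> real \<Rightarrow> (real \<times> real) set" where
  "region M e U0 =
     {(v, r_ext M e u v) | u v. - U0 \<le> u \<and> 1 \<le> v}
   \<union> {(v, r_plus M e) | v. 1 \<le> v}
   \<union> {(v, r_int M e u v) | u v. u \<le> - 1 \<and> 1 \<le> v}"

definition on_ext :: "real \<Rightarrow> real \<Rightarrow> (real \<times> real \<Rightarrow> real) \<Rightarrow> real \<Rightarrow> real \<Rightarrow> real" where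
  "on_ext M e \<phi> u v = \<phi> (v, r_ext M e u v)"

definition on_int :: "real \<Rightarrow> real \<Rightarrow> (real \<times> real \<Rightarrow> real) \<Rightarrow> real \<Rightarrow> real \<Rightarrow> real" where
  "on_int M e \<phi> u v = \<phi> (v, r_int M e u v)"

definition rphi_ext :: "real \<Rightarrow> real \<Rightarrow> (real \<times> real \<Rightarrow> real) \<Rightarrow> real \<Rightarrow> real \<Rightarrow> real" where
  "rphi_ext M e \<phi> u v = r_ext M e u v * on_ext M e \<phi> u v"

definition rphi_int :: "real \<Rightarrow> real \<Rightarrow> (real \<times> real \<Rightarrow> real) \<Rightarrow> real \<Rightarrow> real \<Rightarrow> real" where
  "rphi_int M e \<phi> u v = r_int M e u v * on_int M e \<phi> u v"

text \<open>
  Partial derivatives in null coordinates on \<open>I \<times> {1..}\<close>, where \<open>I\<close> is \<open>{-U0..}\<close> in the exterior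
  and \<open>{..-1}\<close> in the interior. They are one-sided on the boundary of the region, since functions
  are unconstrained outside it.
\<close>

definition d_v :: "(real \<Rightarrow> real \<Rightarrow> real) \<Rightarrow> real \<Rightarrow> real \<Rightarrow> real" where
  "d_v f u v = vector_derivative (\<lambda>v'. f u v') (at v within {1..})"

definition d_u :: "real set \<Rightarrow> (real \<Rightarrow> real \<Rightarrow> real) \<Rightarrow> real \<Rightarrow> real \<Rightarrow> real" where
  "d_u I f u v = vector_derivative (\<lambda>u'. f u' v) (at u within I)"

definition C1_on :: "(real \<times> real) set \<Rightarrow> (real \<times> real \<Rightarrow> real) \<Rightarrow> bool" where
  "C1_on S \<phi> \<longleftrightarrow> (\<exists>p q. continuous_on S p \<and> continuous_on S q \<and>
     (\<forall>x\<in>S. (\<phi> has_derivative (\<lambda>(h, k). p x * h + q x * k)) (at x within S)))"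

text \<open>
  The wave equation for \<open>f\<close> on \<open>I \<times> {1..}\<close>, with area radius \<open>\<rho>\<close>; \<open>w\<close> is \<open>\<partial>\<^sub>u\<partial>\<^sub>v f\<close>.
\<close>

definition wave_eq :: "real set \<Rightarrow> (real \<Rightarrow> real \<Rightarrow> real) \<Rightarrow> (real \<Rightarrow> real \<Rightarrow> real) \<Rightarrow> bool" where
  "wave_eq I \<rho> f \<longleftrightarrow> (\<exists>w. continuous_on (I \<times> {1..}) (\<lambda>(u, v). w u v) \<and>
     (\<forall>u\<in>I. \<forall>v\<ge>1.
        ((\<lambda>u'. d_v f u' v) has_real_derivative w u v) (at u within I) \<and>
        w u v = - (d_v \<rho> u v * d_u I f u v / \<rho> u v) - d_u I \<rho> u v * d_v f u v / \<rho> u v))"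

text \<open>
  No separate equation is imposed on the horizon, where the null coordinates degenerate: in
  \<open>(v, r)\<close> coordinates it follows by continuity from the two sides for functions that are
  continuously differentiable across the horizon.
\<close>

definition wave_solution :: "real \<Rightarrow> real \<Rightarrow> real \<Rightarrow> (real \<times> real \<Rightarrow> real) \<Rightarrow> bool" where
  "wave_solution M e U0 \<phi> \<longleftrightarrow>
     C1_on (region M e U0) \<phi> \<and>
     wave_eq {- U0..} (r_ext M e) (on_ext M e \<phi>) \<and>
     wave_eq {..- 1} (r_int M e) (on_int M e \<phi>)"

definition data_bounds :: "real \<Rightarrow> real \<Rightarrow> real \<Rightarrow> real \<Rightarrow> (real \<times> real \<Rightarrow> real) \<Rightarrow> bool" where
  "data_bounds M e U0 D \<phi> \<longleftrightarrow>
     (\<forall>v\<ge>1.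
        (r_ext M e (- U0) v)^2
          * \<bar>d_v (on_ext M e \<phi>) (- U0) v / d_v (r_ext M e) (- U0) v\<bar> \<le> D \<and>
        (r_ext M e (- U0) v)^3
          * \<bar>d_v (rphi_ext M e \<phi>) (- U0) v / d_v (r_ext M e) (- U0) v\<bar> \<le> D) \<and>
     (\<forall>u\<ge>- U0.
        \<bar>d_u {- U0..} (on_ext M e \<phi>) u 1 / d_u {- U0..} (r_ext M e) u 1\<bar> \<le> D \<and>
        \<bar>d_u {- U0..} (rphi_ext M e \<phi>) u 1 / d_u {- U0..} (r_ext M e) u 1\<bar> \<le> D) \<and>
     (\<forall>u\<le>- 1.
        \<bar>d_u {..- 1} (on_int M e \<phi>) u 1 / d_u {..- 1} (r_int M e) u 1\<bar> \<le> D \<and>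
        \<bar>d_u {..- 1} (rphi_int M e \<phi>) u 1 / d_u {..- 1} (r_int M e) u 1\<bar> \<le> D)"

definition limit_condition :: "real \<Rightarrow> real \<Rightarrow> real \<Rightarrow> (real \<times> real \<Rightarrow> real) \<Rightarrow> bool" where
  "limit_condition M e U0 \<phi> \<longleftrightarrow>
     (\<exists>l. ((\<lambda>v. (r_ext M e (- U0) v)^3 * d_v (rphi_ext M e \<phi>) (- U0) v) \<longlongrightarrow> l) at_top)"

definition rad_field :: "real \<Rightarrow> real \<Rightarrow> (real \<times> real \<Rightarrow> real) \<Rightarrow> real \<Rightarrow> real" where
  "rad_field M e \<phi> u = Lim at_top (\<lambda>v. rphi_ext M e \<phi> u v)"

definition frakL :: "real \<Rightarrow> real \<Rightarrow> real \<Rightarrow> (real \<times> real \<Rightarrow> real) \<Rightarrow> real" where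
  "frakL M e U0 \<phi> =
     Lim at_top (\<lambda>v. (r_ext M e (- U0) v)^3 * d_v (rphi_ext M e \<phi>) (- U0) v)
     - integral {- U0..} (\<lambda>u. 2 * M * rad_field M e \<phi> u)"

end

theory Submission
  imports Defs "HOL-Real_Asymp.Real_Asymp"
begin

text \<open>
  Only the exterior matters. Writing \<open>\<psi> = r \<phi>\<close>, the wave equation becomes
  \<open>\<partial>\<^sub>u \<partial>\<^sub>v \<psi> = - V \<psi>\<close> with \<open>0 \<le> V \<le> 2 M / r\<^sup>3\<close> and \<open>r\<^sup>3 V \<longrightarrow> 2 M\<close> as \<open>r \<longrightarrow> \<infinity>\<close>.
  For bounded \<open>u\<close> a Gronwall argument gives \<open>\<psi> = O(1)\<close> and \<open>\<partial>\<^sub>v \<psi> = O(v\<^sup>-\<^sup>3)\<close>. For large \<open>u\<close> and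
  \<open>r \<ge> R1\<close> the decay \<open>\<psi> = O(u\<^sup>-\<^sup>3)\<close> on \<open>r = R1\<close> improves this to
  \<open>\<bar>\<psi>\<bar> \<le> A min (u\<^sup>-\<^sup>2, r u\<^sup>-\<^sup>3)\<close>, so that \<open>v\<^sup>3 V \<bar>\<psi>\<bar> \<le> C M A (u\<^sup>-\<^sup>2 + r\<^sup>-\<^sup>2)\<close>, where \<open>u \<le> v / 2\<close> and
  \<open>u \<ge> v / 2\<close> account for the two terms.
  Integrating in \<open>u\<close>, the change of \<open>v\<^sup>3 \<partial>\<^sub>v \<psi>\<close> between \<open>u = U2\<close> and \<open>r = R\<close> is at most
  \<open>C M A (1 / U2 + 1 / R)\<close>, which is small for \<open>U2\<close> and \<open>R\<close> large, while between \<open>u = - U0\<close> and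
  \<open>u = U2\<close> it converges to \<open>- \<integral> 2 M \<Phi>\<close> as \<open>v \<longrightarrow> \<infinity>\<close>, uniformly in the solution. Hence
  \<open>v\<^sup>3 \<partial>\<^sub>v \<psi>\<close> on \<open>r = R\<close> is eventually close to \<open>L\<close>.
\<close>

section \<open>Calculus\<close>

text \<open>Mean value inequality with a varying majorant. The derivatives are taken within a larger
  set \<open>S\<close> because those of a solution are one-sided on the boundary of its
  domain.\<close>

lemma abs_diff_le_of_deriv:
  fixes f h :: "real \<Rightarrow> real"
  assumes "a \<le> b" "{a..b} \<subseteq> S"
    and f: "\<And>x. a \<le> x \<Longrightarrow> x \<le> b \<Longrightarrow> (f has_real_derivative f' x) (at x within S)"
    and h: "\<And>x. a \<le> x \<Longrightarrow> x \<le> b \<Longrightarrow> (h has_real_derivative h' x) (at x within S)"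
    and le: "\<And>x. a \<le> x \<Longrightarrow> x \<le> b \<Longrightarrow> \<bar>f' x\<bar> \<le> h' x"
  shows "\<bar>f b - f a\<bar> \<le> h b - h a"
proof (cases "a = b")
  case False
  have f1: "(f has_real_derivative f' x) (at x within {a..b})" if "a \<le> x" "x \<le> b" for x
    using f[OF that] assms(2) by (rule DERIV_subset)
  have h1: "(h has_real_derivative h' x) (at x within {a..b})" if "a \<le> x" "x \<le> b" for x
    using h[OF that] assms(2) by (rule DERIV_subset)
  have "norm (f b - f a) \<le> h b - h a"
  proof (rule differentiable_bound_general[where f' = f' and \<phi>' = h'])
    show "continuous_on {a..b} f" by (rule DERIV_continuous_on) (use f1 in auto)
    show "continuous_on {a..b} h" by (rule DERIV_continuous_on) (use h1 in auto)
    fix x assume x: "a < x" "x < b"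
    have at: "at x within {a..b} = at x" using x by (intro at_within_interior) simp
    show "(f has_vector_derivative f' x) (at x)" "(h has_vector_derivative h' x) (at x)"
      using f1[of x] h1[of x] x unfolding at
      by (auto simp: has_real_derivative_iff_has_vector_derivative)
    show "norm (f' x) \<le> h' x" using le x by simp
  qed (use False assms in auto)
  then show ?thesis by simp
qed simp

text \<open>The Cauchy criterion along \<open>c + real n\<close> gives a limit, and letting the
  right endpoint tend to infinity in the hypothesis gives the rate.\<close>

lemma tendsto_of_diff_bound:
  fixes F k :: "real \<Rightarrow> real"
  assumes le: "\<And>a b. c \<le> a \<Longrightarrow> a \<le> b \<Longrightarrow> \<bar>F b - F a\<bar> \<le> k a"
    and k: "(k \<longlongrightarrow> 0) at_top"
  shows "(F \<longlongrightarrow> Lim at_top F) at_top" "c \<le> a \<Longrightarrow> \<bar>F a - Lim at_top F\<bar> \<le> k a"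
proof -
  define X where "X n = F (c + real n)" for n
  have lim: "filterlim (\<lambda>n. c + real n) at_top sequentially" by real_asymp
  have k0: "(\<lambda>n. k (c + real n)) \<longlonglongrightarrow> 0" using filterlim_compose[OF k lim] .
  have "Cauchy X"
  proof (rule CauchyI)
    fix \<epsilon> :: real assume "0 < \<epsilon>"
    then have "\<forall>\<^sub>F n in sequentially. k (c + real n) < \<epsilon> / 2"
      using order_tendstoD(2)[OF k0, of "\<epsilon> / 2"] by simp
    then obtain N where N: "k (c + real N) < \<epsilon> / 2" by (auto simp: eventually_sequentially)
    have "norm (X m - X n) < \<epsilon>" if "N \<le> m" "N \<le> n" for m n
    proof -
      have "\<bar>X m - X N\<bar> \<le> k (c + real N)" "\<bar>X n - X N\<bar> \<le> k (c + real N)"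
        unfolding X_def using that by (intro le; simp)+
      then show ?thesis using N unfolding real_norm_def by (smt (verit) field_sum_of_halves)
    qed
    then show "\<exists>N. \<forall>m\<ge>N. \<forall>n\<ge>N. norm (X m - X n) < \<epsilon>" by blast
  qed
  then obtain l where l: "X \<longlonglongrightarrow> l" using real_Cauchy_convergent convergent_def by blast
  have bound: "\<bar>F a - l\<bar> \<le> k a" if "c \<le> a" for a
  proof -
    have "(\<lambda>n. \<bar>X n - F a\<bar>) \<longlonglongrightarrow> \<bar>l - F a\<bar>" by (intro tendsto_intros l)
    moreover have "\<forall>\<^sub>F n in sequentially. a \<le> c + real n"
      using lim by (simp add: filterlim_at_top)
    then have "\<forall>\<^sub>F n in sequentially. \<bar>X n - F a\<bar> \<le> k a"
      by eventually_elim (auto simp: X_def intro: le that)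
    ultimately have "\<bar>l - F a\<bar> \<le> k a"
      by (rule tendsto_upperbound) simp
    then show ?thesis by (simp add: abs_minus_commute)
  qed
  have "((\<lambda>a. F a - l) \<longlongrightarrow> 0) at_top"
  proof (rule Lim_null_comparison[OF _ k])
    show "\<forall>\<^sub>F a in at_top. norm (F a - l) \<le> k a"
      using eventually_ge_at_top[of c] by eventually_elim (simp add: bound)
  qed
  then have "(F \<longlongrightarrow> l) at_top" by (simp add: LIM_zero_iff)
  moreover from this have "Lim at_top F = l" by (intro tendsto_Lim) auto
  ultimately show "(F \<longlongrightarrow> Lim at_top F) at_top" "c \<le> a \<Longrightarrow> \<bar>F a - Lim at_top F\<bar> \<le> k a"
    using bound by auto
qed

text \<open>Continuity gives measurability, and domination by \<open>A / u^2\<close> then gives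
  integrability on the half-line.\<close>

lemma integral_inverse_square_tail:
  fixes f :: "real \<Rightarrow> real"
  assumes "0 < a" "continuous_on {a..} f" "\<And>u. a \<le> u \<Longrightarrow> \<bar>f u\<bar> \<le> A / u\<^sup>2"
  shows "f integrable_on {a..}" "\<bar>integral {a..} f\<bar> \<le> A / a"
proof -
  have "((\<lambda>u. A * (1 / u\<^sup>2)) has_integral A * (1 / a)) {a..}"
    using has_integral_inverse_power_to_inf[of 2 a] assms(1) by (intro has_integral_mult_right) simp
  then have i: "((\<lambda>u. A / u\<^sup>2) has_integral A / a) {a..}" by simp
  show f: "f integrable_on {a..}"
  proof (rule measurable_bounded_by_integrable_imp_integrable_real)
    show "f \<in> borel_measurable (lebesgue_on {a..})"
      using assms(2) by (rule continuous_imp_measurable_on_sets_lebesgue) simp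
    show "(\<lambda>u. A / u\<^sup>2) integrable_on {a..}" using i by blast
  qed (use assms in auto)
  have "norm (integral {a..} f) \<le> integral {a..} (\<lambda>u. A / u\<^sup>2)"
    using assms i by (intro integral_norm_bound_integral f) auto
  then show "\<bar>integral {a..} f\<bar> \<le> A / a" using i by (simp add: integral_unique)
qed

text \<open>Uniqueness of derivatives within a half-line, also at its endpoint, rests on this; it
  allows \<open>d_v\<close> and \<open>d_u\<close> to be computed.\<close>

lemma at_within_atLeast_nontrivial:
  fixes a x :: real
  assumes "a \<le> x"
  shows "at x within {a..} \<noteq> bot"
proof -
  have "x islimpt {x..x + 1}" by (simp add: islimpt_Icc)
  then have "x islimpt {a..}" by (rule islimpt_subset) (use assms in auto)
  then show ?thesis by (simp add: trivial_limit_within)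
qed

lemma d_v_eq:
  assumes "1 \<le> v" "((\<lambda>v'. f u v') has_real_derivative y) (at v within {1..})"
  shows "d_v f u v = y"
  unfolding d_v_def
  using assms by (intro vector_derivative_within at_within_atLeast_nontrivial)
    (simp_all add: has_real_derivative_iff_has_vector_derivative)

lemma d_u_eq:
  assumes "a \<le> u" "((\<lambda>u'. f u' v) has_real_derivative y) (at u within {a..})"
  shows "d_u {a..} f u v = y"
  unfolding d_u_def
  using assms by (intro vector_derivative_within at_within_atLeast_nontrivial)
    (simp_all add: has_real_derivative_iff_has_vector_derivative)

section \<open>The area radius and the potential\<close>

locale subextremal =
  fixes M e :: real
  assumes e_pos: "0 < \<bar>e\<bar>" and e_less: "\<bar>e\<bar> < M"
begin

definition lapse :: "real \<Rightarrow> real" where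
  "lapse r = 1 - 2 * M / r + e\<^sup>2 / r\<^sup>2"

text \<open>In the exterior the radius depends on \<open>v - u\<close> alone, so one variable
  suffices.\<close>

definition area :: "real \<Rightarrow> real" where
  "area x = inv_into {r_plus M e<..} (r_star M e) x"

text \<open>This is \<open>F F' / r\<close> for the lapse \<open>F\<close>, the coefficient that
  remains when the wave equation is rewritten for \<open>r \<phi>\<close>.\<close>

definition pot :: "real \<Rightarrow> real" where
  "pot r = 2 * (M - e\<^sup>2 / r) * lapse r / r ^ 3"

lemma M_pos: "0 < M"
  using e_pos e_less by linarith

lemma e_sq: "0 < e\<^sup>2" "e\<^sup>2 < M\<^sup>2"
  using e_pos e_less by (auto simp: power2_strict_mono)

lemma r_plus_gt: "M < r_plus M e"
  using e_sq by (simp add: r_plus_def)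

lemma r_plus_le: "r_plus M e \<le> 2 * M"
proof -
  have "sqrt (M\<^sup>2 - e\<^sup>2) \<le> sqrt (M\<^sup>2)"
    by (rule real_sqrt_le_mono) simp
  then show ?thesis using M_pos by (simp add: r_plus_def)
qed

lemma lapse_factor:
  assumes "r \<noteq> 0"
  shows "lapse r = (r - r_plus M e) * (r - r_minus M e) / r\<^sup>2"
proof -
  have "(r - r_plus M e) * (r - r_minus M e) = r\<^sup>2 - 2 * M * r + (M\<^sup>2 - (sqrt (M\<^sup>2 - e\<^sup>2))\<^sup>2)"
    by (simp add: r_plus_def r_minus_def algebra_simps power2_eq_square)
  also have "\<dots> = r\<^sup>2 - 2 * M * r + e\<^sup>2"
    using e_sq by simp
  finally show ?thesis
    using assms by (simp add: lapse_def field_simps power2_eq_square)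
qed

lemma r_minus_less: "r_minus M e < r_plus M e"
  using e_sq by (simp add: r_plus_def r_minus_def)

lemma lapse_pos: "r_plus M e < r \<Longrightarrow> 0 < lapse r"
  using r_minus_less r_plus_gt M_pos by (subst lapse_factor) auto

lemma lapse_less_1:
  assumes "r_plus M e < r"
  shows "lapse r < 1"
proof -
  have r: "M < r" "0 < r" using assms r_plus_gt M_pos by linarith+
  have "e\<^sup>2 < M * M" using e_sq by (simp add: power2_eq_square)
  also have "\<dots> < 2 * M * r" using r M_pos by (intro mult_strict_mono) auto
  finally show ?thesis using r by (simp add: lapse_def field_simps power2_eq_square)
qed

lemma lapse_ge:
  assumes "4 * M \<le> r"
  shows "1 / 2 \<le> lapse r"
proof -
  have r: "0 < r" using assms M_pos by linarith
  have "2 * M / r \<le> 1 / 2" using r assms by (simp add: field_simps)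
  then show ?thesis using zero_le_power2[of "e / r"] unfolding lapse_def power_divide by linarith
qed

section \<open>The tortoise coordinate as an increasing bijection onto the real line\<close>

lemma DERIV_r_star:
  assumes "r_plus M e < r"
  shows "(r_star M e has_real_derivative 1 / lapse r) (at r)"
proof -
  define s where "s = sqrt (M\<^sup>2 - e\<^sup>2)"
  have s: "0 < s" "s\<^sup>2 = M\<^sup>2 - e\<^sup>2" using e_sq by (auto simp: s_def)
  have rp: "r_plus M e = M + s" "r_minus M e = M - s"
    by (auto simp: r_plus_def r_minus_def s_def)
  have r: "0 < r - (M + s)" "0 < r - (M - s)" "r > 0"
    using assms rp s M_pos by linarith+
  have ee: "e\<^sup>2 = M\<^sup>2 - s\<^sup>2" using s by simp
  define \<alpha> where "\<alpha> = M + (2 * M\<^sup>2 - e\<^sup>2) / (2 * s)"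
  define \<beta> where "\<beta> = M - (2 * M\<^sup>2 - e\<^sup>2) / (2 * s)"
  \<comment> \<open>The logarithmic coefficients are the residues of \<open>1 / lapse\<close> at its
    two poles \<open>M + s\<close> and \<open>M - s\<close>.\<close>
  have ab: "\<alpha> = (M + s)\<^sup>2 / (2 * s)" "\<beta> = - (M - s)\<^sup>2 / (2 * s)"
    using s(1) unfolding \<alpha>_def \<beta>_def ee by (simp_all add: field_simps power2_eq_square)
  have D: "((\<lambda>x. x + \<alpha> * ln (x - (M + s)) + \<beta> * ln (x - (M - s)))
      has_real_derivative (1 + \<alpha> / (r - (M + s)) + \<beta> / (r - (M - s)))) (at r)"
    using r by (auto intro!: derivative_eq_intros)
  \<comment> \<open>Written with the distances \<open>p\<close> and \<open>q\<close> to the two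
    poles, the partial fraction identity is purely rational.\<close>
  define p q where "p = r - (M + s)" and "q = r - (M - s)"
  have pq: "0 < p" "0 < q" "2 * s = q - p" "M + s = r - p" "M - s = r - q" "p < q"
    using r s by (auto simp: p_def q_def)
  have "1 + \<alpha> / p + \<beta> / q = r\<^sup>2 / (p * q)"
    unfolding ab pq(3,4,5) using pq(1,2,6)
    by (simp add: divide_simps) (simp add: algebra_simps power2_eq_square)
  also have "\<dots> = 1 / lapse r"
    using r by (subst lapse_factor) (auto simp: rp p_def q_def)
  finally have eq: "1 + \<alpha> / (r - (M + s)) + \<beta> / (r - (M - s)) = 1 / lapse r"
    by (simp add: p_def q_def)
  show ?thesis
  proof (rule has_field_derivative_transform_within_open[OF D[unfolded eq], of "{M + s<..}"])
    fix x assume "x \<in> {M + s<..}"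
    then show "x + \<alpha> * ln (x - (M + s)) + \<beta> * ln (x - (M - s)) = r_star M e x"
      using s by (simp add: r_star_def rp \<alpha>_def \<beta>_def s_def[symmetric])
  qed (use r in auto)
qed

lemma r_star_strict_mono:
  assumes "r_plus M e < a" "a < b"
  shows "r_star M e a < r_star M e b"
proof (rule DERIV_pos_imp_increasing[OF assms(2)])
  fix x assume "a \<le> x" "x \<le> b"
  then have "r_plus M e < x" using assms by linarith
  then show "\<exists>y. (r_star M e has_real_derivative y) (at x) \<and> 0 < y"
    using DERIV_r_star lapse_pos by (meson divide_pos_pos zero_less_one)
qed

lemma continuous_on_r_star: "continuous_on {r_plus M e<..} (r_star M e)"
  by (meson DERIV_isCont DERIV_r_star continuous_at_imp_continuous_on greaterThan_iff)

text \<open>The slope \<open>1 / lapse r\<close> is at least 1 outside the horizon.\<close>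

lemma r_star_ge_diff:
  assumes "r_plus M e < a" "a \<le> b"
  shows "b - a \<le> r_star M e b - r_star M e a"
proof -
  have "(\<lambda>x. r_star M e x - x) a \<le> (\<lambda>x. r_star M e x - x) b"
  proof (rule DERIV_nonneg_imp_nondecreasing[OF assms(2)])
    fix x assume "a \<le> x" "x \<le> b"
    then have x: "r_plus M e < x" using assms by linarith
    have "((\<lambda>x. r_star M e x - x) has_real_derivative (1 / lapse x - 1)) (at x)"
      by (intro derivative_intros DERIV_r_star x)
    moreover have "0 \<le> 1 / lapse x - 1"
      using lapse_pos[OF x] lapse_less_1[OF x] by (simp add: field_simps)
    ultimately show "\<exists>y. ((\<lambda>x. r_star M e x - x) has_real_derivative y) (at x) \<and> 0 \<le> y"
      by blast
  qed
  then show ?thesis by simp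
qed

text \<open>From \<open>4 * M\<close> on the lapse is at least 1/2, so the slope of
  \<open>r_star\<close> is at most 2.\<close>

lemma r_star_le_diff:
  assumes "4 * M \<le> a" "a \<le> b"
  shows "r_star M e b - r_star M e a \<le> 2 * (b - a)"
proof -
  have "(\<lambda>x. 2 * x - r_star M e x) a \<le> (\<lambda>x. 2 * x - r_star M e x) b"
  proof (rule DERIV_nonneg_imp_nondecreasing[OF assms(2)])
    fix x assume "a \<le> x" "x \<le> b"
    then have x: "4 * M \<le> x" "r_plus M e < x" using assms r_plus_le M_pos by linarith+
    have "((\<lambda>x. 2 * x - r_star M e x) has_real_derivative (2 - 1 / lapse x)) (at x)"
      by (auto intro!: derivative_eq_intros DERIV_r_star x)
    moreover have "0 \<le> 2 - 1 / lapse x"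
      using lapse_ge[OF x(1)] by (simp add: field_simps)
    ultimately show "\<exists>y. ((\<lambda>x. 2 * x - r_star M e x) has_real_derivative y) (at x) \<and> 0 \<le> y"
      by blast
  qed
  then show ?thesis by simp
qed

text \<open>The coefficient of the logarithm that is singular at the horizon is positive, and the
  other terms stay bounded there.\<close>

lemma r_star_at_right: "filterlim (r_star M e) at_bot (at_right (r_plus M e))"
proof -
  define s where "s = sqrt (M\<^sup>2 - e\<^sup>2)"
  define \<alpha> where "\<alpha> = M + (2 * M\<^sup>2 - e\<^sup>2) / (2 * s)"
  define \<beta> where "\<beta> = M - (2 * M\<^sup>2 - e\<^sup>2) / (2 * s)"
  have s: "0 < s" using e_sq by (auto simp: s_def)
  have rp: "r_plus M e = M + s" "r_minus M e = M - s"
    by (auto simp: r_plus_def r_minus_def s_def)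
  have "e\<^sup>2 \<le> 2 * M\<^sup>2" using e_sq by linarith
  then have "0 < \<alpha>" using s M_pos unfolding \<alpha>_def
    by (intro add_pos_nonneg divide_nonneg_pos) auto
  then have lim: "filterlim (\<lambda>x. x + \<alpha> * ln (x - (M + s)) + \<beta> * ln (x - (M - s))) at_bot (at_right (M + s))"
    using s by real_asymp
  have ev: "\<forall>\<^sub>F x in at_right (M + s).
      x + \<alpha> * ln (x - (M + s)) + \<beta> * ln (x - (M - s)) = r_star M e x"
    using s by (intro eventually_at_rightI[of "M + s" "M + s + 1"])
      (auto simp: r_star_def rp \<alpha>_def \<beta>_def s_def[symmetric])
  show ?thesis
    unfolding rp using filterlim_cong[OF refl refl ev] lim by blast
qed

lemma r_star_asymp: "((\<lambda>r. r_star M e r / r) \<longlongrightarrow> 1) at_top"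
  unfolding r_star_def by real_asymp

lemma r_star_image: "r_star M e ` {r_plus M e<..} = UNIV"
proof (intro equalityI subset_UNIV subsetI)
  fix y :: real
  let ?b = "r_plus M e"
  have "\<forall>\<^sub>F r in at_right ?b. r_star M e r \<le> y"
    using r_star_at_right by (auto simp: filterlim_at_bot)
  moreover have "\<forall>\<^sub>F r in at_right ?b. ?b < r" by (simp add: eventually_at_right_less)
  ultimately have "\<forall>\<^sub>F r in at_right ?b. r_star M e r \<le> y \<and> ?b < r"
    by (rule eventually_conj)
  then obtain a where a: "r_star M e a \<le> y" "?b < a"
    using eventually_happens by fastforce
  \<comment> \<open>Since \<open>r_star\<close> has slope at least 1, moving right by the missing
    amount reaches \<open>y\<close> or passes it.\<close>
  define c where "c = a + (y - r_star M e a)"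
  have c: "a \<le> c" "y \<le> r_star M e c"
    using r_star_ge_diff[of a c] a by (auto simp: c_def)
  have "continuous_on {a..c} (r_star M e)"
    using continuous_on_r_star by (rule continuous_on_subset) (use a in auto)
  then obtain x where "a \<le> x" "x \<le> c" "r_star M e x = y"
    using IVT'[of "r_star M e" a y c] a c by auto
  then show "y \<in> r_star M e ` {?b<..}" using a by force
qed

section \<open>The area radius as a function of the tortoise coordinate\<close>

lemma area_gt: "r_plus M e < area x"
  using inv_into_into[of x "r_star M e" "{r_plus M e<..}"] r_star_image by (simp add: area_def)

lemma r_star_area: "r_star M e (area x) = x"
  using r_star_image by (simp add: area_def f_inv_into_f)

lemma inj_r_star: "inj_on (r_star M e) {r_plus M e<..}"
  by (rule inj_onI) (metis greaterThan_iff linorder_neqE_linordered_idom order_less_irrefl r_star_strict_mono)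

lemma area_r_star: "r_plus M e < r \<Longrightarrow> area (r_star M e r) = r"
  unfolding area_def by (rule inv_into_f_f[OF inj_r_star]) simp

lemma area_pos: "0 < area x"
  using area_gt[of x] r_plus_gt M_pos by linarith

lemma area_mono: "x \<le> y \<Longrightarrow> area x \<le> area y"
  by (metis area_gt linorder_not_le r_star_area r_star_strict_mono)

lemma area_diff_le: "x \<le> y \<Longrightarrow> area y - area x \<le> y - x"
  using r_star_ge_diff[OF area_gt area_mono] by (simp add: r_star_area)

text \<open>The inverse of a function of slope at least 1 is 1-Lipschitz. Continuity is what the
  inverse function rule asks for in \<open>DERIV_area\<close>.\<close>

lemma continuous_on_area: "continuous_on UNIV area"
proof (rule lipschitz_on_continuous_on)
  show "1-lipschitz_on UNIV area"
  proof (rule lipschitz_onI)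
    fix x y :: real
    show "dist (area x) (area y) \<le> 1 * dist x y"
      using area_diff_le[of x y] area_diff_le[of y x] area_mono[of x y] area_mono[of y x]
      by (cases "x \<le> y") (auto simp: dist_real_def)
  qed simp
qed

lemma DERIV_area: "(area has_real_derivative lapse (area x)) (at x)"
proof -
  have "isCont area x"
    using continuous_on_area continuous_on_eq_continuous_at by blast
  then have "(area has_real_derivative inverse (1 / lapse (area x))) (at x)"
    using lapse_pos[OF area_gt[of x]]
    by (intro DERIV_inverse_function[where f = "r_star M e" and g = area and x = x
          and a = "x - 1" and b = "x + 1"] DERIV_r_star area_gt)
      (auto simp: r_star_area)
  then show ?thesis by simp
qed

text \<open>Beyond \<open>4 * M\<close> the slope of \<open>r_star\<close> is at most 2, so its
  inverse gains at least half the increment of its argument.\<close>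

lemma area_lower:
  assumes "4 * M \<le> a" "r_star M e a \<le> x"
  shows "a + (x - r_star M e a) / 2 \<le> area x"
proof -
  have a: "r_plus M e < a" using assms(1) r_plus_le M_pos by linarith
  have "a \<le> area x" using area_mono[OF assms(2)] area_r_star[OF a] by simp
  then show ?thesis
    using r_star_le_diff[OF assms(1), of "area x"] unfolding r_star_area by argo
qed

lemma filterlim_area: "filterlim area at_top at_top"
proof (rule filterlim_at_top_mono)
  show "filterlim (\<lambda>x. 4 * M + (x - r_star M e (4 * M)) / 2) at_top at_top" by real_asymp
  show "\<forall>\<^sub>F x in at_top. 4 * M + (x - r_star M e (4 * M)) / 2 \<le> area x"
    using eventually_ge_at_top[of "r_star M e (4 * M)"]
    by eventually_elim (rule area_lower, simp_all)
qed

text \<open>Used to trade powers of the radius for powers of \<open>v\<close> in limits at null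
  infinity.\<close>

lemma area_asymp: "((\<lambda>x. x / area x) \<longlongrightarrow> 1) at_top"
  using filterlim_compose[OF r_star_asymp filterlim_area] by (simp add: r_star_area)

section \<open>The size of the potential\<close>

lemma pot_asymp: "((\<lambda>r. r ^ 3 * pot r) \<longlongrightarrow> 2 * M) at_top"
  unfolding pot_def lapse_def by real_asymp

text \<open>Outside the horizon \<open>e^2 < M^2 < M * r\<close>, so \<open>M - e^2 / r\<close> lies
  between 0 and \<open>M\<close>, while the lapse lies between 0 and 1.\<close>

lemma pot_bounds:
  assumes "r_plus M e < r"
  shows "0 \<le> pot r" "pot r \<le> 2 * M / r ^ 3"
proof -
  have r: "M < r" "0 < r" using assms r_plus_gt M_pos by linarith+
  have "e\<^sup>2 < M * M" using e_sq by (simp add: power2_eq_square)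
  also have "\<dots> < M * r" using r M_pos by simp
  finally have q: "0 \<le> M - e\<^sup>2 / r" "M - e\<^sup>2 / r \<le> M" using r by (auto simp: field_simps)
  have l: "0 \<le> lapse r" "lapse r \<le> 1"
    using lapse_pos[OF assms] lapse_less_1[OF assms] by auto
  show "0 \<le> pot r" using q l r by (simp add: pot_def)
  have "(M - e\<^sup>2 / r) * lapse r \<le> M * 1"
    using q l M_pos by (intro mult_mono) auto
  then show "pot r \<le> 2 * M / r ^ 3"
    using r unfolding pot_def mult.assoc by (intro divide_right_mono) auto
qed

lemma DERIV_lapse:
  assumes "r \<noteq> 0"
  shows "(lapse has_real_derivative 2 * (M - e\<^sup>2 / r) / r\<^sup>2) (at r)"
  unfolding lapse_def[abs_def] using assms
  by (auto intro!: derivative_eq_intros simp: field_simps power2_eq_square)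

section \<open>A priori bounds\<close>

text \<open>The factor \<open>2048 = 32 * 64\<close> makes \<open>32 * M / R1\<close> equal to
  \<open>1 / 64\<close>, which is what the absorption in \<open>far_bound\<close> uses.\<close>

abbreviation R1 :: real where "R1 \<equiv> 2048 * M"

text \<open>
  Here \<open>\<psi>\<close> stands for \<open>r \<phi>\<close>, \<open>g\<close> for \<open>\<partial>\<^sub>v \<psi>\<close>, and \<open>A\<close> for \<open>R1 A'\<close> with the constant \<open>A'\<close> of the
  decay assumption.
\<close>

definition char_wave ::
    "real \<Rightarrow> real \<Rightarrow> real \<Rightarrow> (real \<Rightarrow> real \<Rightarrow> real) \<Rightarrow> (real \<Rightarrow> real \<Rightarrow> real) \<Rightarrow> bool" where
  "char_wave U0 D A \<psi> g \<longleftrightarrow>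
     continuous_on ({- U0..} \<times> {1..}) (\<lambda>(u, v). \<psi> u v) \<and>
     (\<forall>u\<ge>- U0. \<forall>v\<ge>1.
        ((\<lambda>v'. \<psi> u v') has_real_derivative g u v) (at v within {1..}) \<and>
        ((\<lambda>u'. g u' v) has_real_derivative - (pot (area (v - u)) * \<psi> u v)) (at u within {- U0..})) \<and>
     (\<forall>v\<ge>1. \<bar>g (- U0) v\<bar> \<le> D / area (v + U0) ^ 3) \<and>
     (\<forall>u\<ge>- U0. \<bar>\<psi> u 1\<bar> \<le> D * area (1 - u) * (1 + area (1 - u))) \<and>
     (\<forall>u\<ge>1. \<forall>v\<ge>1. area (v - u) = R1 \<longrightarrow> \<bar>\<psi> u v\<bar> \<le> A / u ^ 3)"

lemma char_waveD:
  assumes "char_wave U0 D A \<psi> g"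
  shows "continuous_on ({- U0..} \<times> {1..}) (\<lambda>(u, v). \<psi> u v)"
    and "- U0 \<le> u \<Longrightarrow> 1 \<le> v \<Longrightarrow> ((\<lambda>v'. \<psi> u v') has_real_derivative g u v) (at v within {1..})"
    and "- U0 \<le> u \<Longrightarrow> 1 \<le> v \<Longrightarrow> ((\<lambda>u'. g u' v) has_real_derivative
           - (pot (area (v - u)) * \<psi> u v)) (at u within {- U0..})"
    and "1 \<le> v \<Longrightarrow> \<bar>g (- U0) v\<bar> \<le> D / area (v + U0) ^ 3"
    and "- U0 \<le> u \<Longrightarrow> \<bar>\<psi> u 1\<bar> \<le> D * area (1 - u) * (1 + area (1 - u))"
    and "1 \<le> u \<Longrightarrow> 1 \<le> v \<Longrightarrow> area (v - u) = R1 \<Longrightarrow> \<bar>\<psi> u v\<bar> \<le> A / u ^ 3"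
  using assms unfolding char_wave_def by blast+

text \<open>Integration of the equation for \<open>g\<close> in \<open>u\<close> at fixed
  \<open>v\<close>. The majorant enters through an antiderivative \<open>h\<close>, so explicit
  functions replace integrals.\<close>

lemma g_diff_le:
  assumes "char_wave U0 D A \<psi> g" "- U0 \<le> a" "a \<le> b" "1 \<le> v"
    and "\<And>u. a \<le> u \<Longrightarrow> u \<le> b \<Longrightarrow> (h has_real_derivative h' u) (at u)"
    and "\<And>u. a \<le> u \<Longrightarrow> u \<le> b \<Longrightarrow> pot (area (v - u)) * \<bar>\<psi> u v\<bar> \<le> h' u"
  shows "\<bar>g b v - g a v\<bar> \<le> h b - h a"
proof (rule abs_diff_le_of_deriv[where S = "{- U0..}" and f = "\<lambda>u. g u v"])
  fix u assume u: "a \<le> u" "u \<le> b"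
  show "((\<lambda>u. g u v) has_real_derivative - (pot (area (v - u)) * \<psi> u v)) (at u within {- U0..})"
    using assms u by (intro char_waveD) auto
  show "(h has_real_derivative h' u) (at u within {- U0..})"
    using assms(5)[OF u] by (rule has_field_derivative_at_within)
  show "\<bar>- (pot (area (v - u)) * \<psi> u v)\<bar> \<le> h' u"
    using assms(6)[OF u] pot_bounds(1)[OF area_gt] by (simp add: abs_mult)
qed (use assms in auto)

text \<open>Two ways to integrate \<open>v^(-3)\<close>: the first bound stays finite as
  \<open>b\<close> grows and later yields the decay \<open>u^(-2)\<close>; the second is linear in
  the length and yields \<open>r u^(-3)\<close>.\<close>

lemma psi_diff_le:
  assumes "char_wave U0 D A \<psi> g" "- U0 \<le> u" "1 \<le> a" "a \<le> b"
    and g: "\<And>v. a \<le> v \<Longrightarrow> v \<le> b \<Longrightarrow> \<bar>g u v\<bar> \<le> K / v ^ 3"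
  shows "\<bar>\<psi> u b - \<psi> u a\<bar> \<le> K / 2 * (1 / a\<^sup>2 - 1 / b\<^sup>2)"
    and "\<bar>\<psi> u b - \<psi> u a\<bar> \<le> K / a ^ 3 * (b - a)"
proof -
  have der: "((\<lambda>v. \<psi> u v) has_real_derivative g u v) (at v within {1..})" if "a \<le> v" for v
    using assms that by (intro char_waveD) auto
  have "\<bar>\<psi> u b - \<psi> u a\<bar> \<le> - K / (2 * b\<^sup>2) - - K / (2 * a\<^sup>2)"
  proof (rule abs_diff_le_of_deriv[where S = "{1..}" and f = "\<lambda>v. \<psi> u v" and h' = "\<lambda>v. K / v ^ 3"
        and h = "\<lambda>v. - K / (2 * v\<^sup>2)"])
    fix v assume v: "a \<le> v" "v \<le> b"
    show "((\<lambda>v. - K / (2 * v\<^sup>2)) has_real_derivative K / v ^ 3) (at v within {1..})"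
      using v assms by (auto intro!: derivative_eq_intros simp: field_simps power2_eq_square power3_eq_cube)
  qed (use assms der in auto)
  then show "\<bar>\<psi> u b - \<psi> u a\<bar> \<le> K / 2 * (1 / a\<^sup>2 - 1 / b\<^sup>2)"
    by (simp add: algebra_simps)
  \<comment> \<open>The sign of \<open>K\<close> follows from the bound on \<open>g\<close> at
    \<open>v = a\<close>.\<close>
  have K: "0 \<le> K"
    using g[of a] assms by (metis abs_ge_zero divide_nonneg_pos dual_order.trans linorder_not_le
        divide_neg_pos order_refl zero_less_one zero_less_power order_less_le_trans)
  have "\<bar>\<psi> u b - \<psi> u a\<bar> \<le> K / a ^ 3 * b - K / a ^ 3 * a"
  proof (rule abs_diff_le_of_deriv[where S = "{1..}" and f = "\<lambda>v. \<psi> u v" and h' = "\<lambda>v. K / a ^ 3"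
        and h = "\<lambda>v. K / a ^ 3 * v"])
    fix v assume v: "a \<le> v" "v \<le> b"
    show "((\<lambda>v. K / a ^ 3 * v) has_real_derivative K / a ^ 3) (at v within {1..})"
      by (rule has_field_derivative_at_within[OF DERIV_cmult_Id])
    have "\<bar>g u v\<bar> \<le> K / v ^ 3" using g v by blast
    also have "\<dots> \<le> K / a ^ 3"
      using v assms K by (intro divide_left_mono power_mono mult_pos_pos) auto
    finally show "\<bar>g u v\<bar> \<le> K / a ^ 3" .
  qed (use assms der in auto)
  then show "\<bar>\<psi> u b - \<psi> u a\<bar> \<le> K / a ^ 3 * (b - a)"
    by (simp add: right_diff_distrib)
qed

lemma area_linear_lower:
  "\<exists>c>0. \<forall>u\<le>U1. \<forall>v\<ge>1. c * v \<le> area (v - u)"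
proof -
  define X where "X = r_star M e (4 * M)"
  \<comment> \<open>For \<open>N \<le> v\<close> at least half of \<open>v\<close> survives in
    \<open>v - u - X\<close>, so the radius exceeds \<open>v / 4\<close>; for smaller
    \<open>v\<close> the constant lower bound \<open>M\<close> on the radius suffices.\<close>
  define N where "N = 2 * \<bar>U1\<bar> + 2 * \<bar>X\<bar> + 1"
  define c where "c = min (1 / 4) (M / N)"
  have N: "0 < N" by (simp add: N_def)
  have c: "0 < c" "c \<le> 1 / 4" "c * N \<le> M"
    using N M_pos by (auto simp: c_def min_def field_simps)
  have "c * v \<le> area (v - u)" if "u \<le> U1" "1 \<le> v" for u v
  proof (cases "N \<le> v")
    case True
    then have "X \<le> v - u" "v \<le> 2 * (v - u - X)" using that by (auto simp: N_def abs_if split: if_splits)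
    moreover from this have "8 * M + (v - u - X) \<le> 2 * area (v - u)"
      using area_lower[of "4 * M" "v - u"] by (simp add: X_def field_simps)
    moreover have "4 * (c * v) \<le> v" using mult_right_mono[OF c(2), of v] that by simp
    ultimately show ?thesis using M_pos by argo
  next
    case False
    then have "c * v \<le> c * N" using c by (intro mult_left_mono) auto
    then show ?thesis using c area_gt[of "v - u"] r_plus_gt by linarith
  qed
  then show ?thesis using c by blast
qed

text \<open>
  Gronwall's inequality in \<open>u\<close>, obtained by maximizing \<open>exp (- L u) \<bar>\<psi>\<bar>\<close> over a compact rectangle.
\<close>

lemma near_bound:
  assumes "0 \<le> D" "- U0 \<le> U1" "0 \<le> U0"
  shows "\<exists>C>0. \<forall>\<psi> g. char_wave U0 D A \<psi> g \<longrightarrow>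
    (\<forall>u v. - U0 \<le> u \<longrightarrow> u \<le> U1 \<longrightarrow> 1 \<le> v \<longrightarrow> \<bar>\<psi> u v\<bar> \<le> C \<and> \<bar>g u v\<bar> \<le> C / v ^ 3)"
proof -
  obtain c where c: "0 < c" and low: "\<And>u v. u \<le> U1 \<Longrightarrow> 1 \<le> v \<Longrightarrow> c * v \<le> area (v - u)"
    using area_linear_lower by blast
  \<comment> \<open>\<open>L\<close> bounds \<open>v^3\<close> times the potential,
    \<open>D'\<close> bounds \<open>v^3\<close> times the initial values of \<open>g\<close>, and
    \<open>B\<close> bounds \<psi> on \<open>v = 1\<close>, where the radius is largest at
    \<open>u = - U0\<close>.\<close>
  define L where "L = 2 * M / c ^ 3"
  define D' where "D' = D / c ^ 3"
  define B where "B = D * area (1 + U0) * (1 + area (1 + U0))"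
  define W0 where "W0 = (2 * B + D') * exp (L * U0)"
  define C where "C = max (W0 * exp (L * U1)) (D' + W0 * exp (L * U1)) + 1"
  have pos: "0 < L" "0 \<le> D'" "0 \<le> B" "0 \<le> W0"
    using c M_pos assms area_pos[of "1 + U0"] by (auto simp: L_def D'_def B_def W0_def)
  have cube: "a / area (v - u) ^ 3 \<le> a / c ^ 3 / v ^ 3" if "u \<le> U1" "1 \<le> v" "0 \<le> a" for a u v
  proof -
    have "a / area (v - u) ^ 3 \<le> a / (c * v) ^ 3"
      using low[OF that(1,2)] c that by (intro divide_left_mono power_mono mult_pos_pos zero_less_power area_pos) auto
    then show ?thesis by (simp add: power_mult_distrib)
  qed
  have pot: "pot (area (v - u)) \<le> L / v ^ 3" if "u \<le> U1" "1 \<le> v" for u v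
    using order_trans[OF pot_bounds(2)[OF area_gt] cube[OF that, of "2 * M"]] M_pos by (simp add: L_def)
  have main: "\<bar>\<psi> u v\<bar> \<le> C \<and> \<bar>g u v\<bar> \<le> C / v ^ 3"
    if w: "char_wave U0 D A \<psi> g" and u: "- U0 \<le> u" "u \<le> U1" and v: "1 \<le> v" for \<psi> g u v
  proof -
    define q where "q = (\<lambda>(u, v). exp (- (L * u)) * \<bar>\<psi> u v\<bar>)"
    have "continuous_on ({- U0..U1} \<times> {1..v}) (\<lambda>(u, v). \<psi> u v)"
      using char_waveD(1)[OF w] by (rule continuous_on_subset) auto
    then have "continuous_on ({- U0..U1} \<times> {1..v}) q"
      unfolding q_def case_prod_beta by (intro continuous_intros)
    moreover have "compact ({- U0..U1} \<times> {1..v})" by (intro compact_Times compact_Icc)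
    moreover have "{- U0..U1} \<times> {1..v} \<noteq> {}" using assms v by auto
    ultimately obtain p where p: "p \<in> {- U0..U1} \<times> {1..v}" and sup: "\<forall>y\<in>{- U0..U1} \<times> {1..v}. q y \<le> q p"
      using continuous_attains_sup by blast
    define W where "W = q p"
    have W0: "0 \<le> W" by (auto simp: W_def q_def case_prod_beta)
    have psi: "\<bar>\<psi> a b\<bar> \<le> W * exp (L * a)" if "- U0 \<le> a" "a \<le> U1" "1 \<le> b" "b \<le> v" for a b
    proof -
      have "exp (- (L * a)) * \<bar>\<psi> a b\<bar> \<le> W" using sup that by (force simp: W_def q_def)
      then show ?thesis by (simp add: exp_minus field_simps)
    qed
    have g: "\<bar>g a b\<bar> \<le> (D' + W * exp (L * a)) / b ^ 3" if "- U0 \<le> a" "a \<le> U1" "1 \<le> b" "b \<le> v" for a b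
    proof -
      \<comment> \<open>The weight reproduces itself: the factor \<open>L\<close> from the potential
        is absorbed when \<open>exp (L * u)\<close> is integrated.\<close>
      have "\<bar>g a b - g (- U0) b\<bar> \<le> W * exp (L * a) / b ^ 3 - W * exp (L * (- U0)) / b ^ 3"
      proof (rule g_diff_le[OF w, where h' = "\<lambda>u. L / b ^ 3 * (W * exp (L * u))"])
        fix x assume x: "- U0 \<le> x" "x \<le> a"
        have "((\<lambda>a. W * exp (L * a)) has_real_derivative W * (exp (L * x) * L)) (at x)"
          by (auto intro!: derivative_eq_intros)
        from DERIV_cdivide[OF this, of "b ^ 3"]
        show "((\<lambda>a. W * exp (L * a) / b ^ 3) has_real_derivative L / b ^ 3 * (W * exp (L * x))) (at x)"
          by (simp add: mult_ac)
        show "pot (area (b - x)) * \<bar>\<psi> x b\<bar> \<le> L / b ^ 3 * (W * exp (L * x))"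
          using x that pos by (intro mult_mono pot psi) auto
      qed (use that in auto)
      moreover have "\<bar>g (- U0) b\<bar> \<le> D' / b ^ 3"
        using order_trans[OF char_waveD(4)[OF w, of b] cube[of "- U0" b D, simplified]] assms that
        by (simp add: D'_def)
      moreover have "0 \<le> W * exp (L * (- U0)) / b ^ 3" using W0 that by simp
      ultimately show ?thesis unfolding add_divide_distrib by linarith
    qed
    \<comment> \<open>\<open>W\<close> depends on the rectangle and on the solution, but the bound
      \<open>W0\<close> depends on neither.\<close>
    have "W \<le> W0"
    proof -
      obtain a b where ab: "p = (a, b)" "- U0 \<le> a" "a \<le> U1" "1 \<le> b" "b \<le> v" using p by auto
      define E where "E = W * exp (L * a)"
      have E: "\<bar>\<psi> a b\<bar> = E" "0 \<le> E"
        using W0 by (auto simp: E_def W_def q_def ab exp_minus)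
      \<comment> \<open>The integral of \<open>v^(-3)\<close> from 1 is at most 1/2, so at the
        maximum point half of \<open>E\<close> can be absorbed.\<close>
      have "\<bar>\<psi> a b - \<psi> a 1\<bar> \<le> (D' + E) / 2 * (1 / 1\<^sup>2 - 1 / b\<^sup>2)"
        using ab g unfolding E_def by (intro psi_diff_le(1)[OF w]) auto
      also have "\<dots> \<le> (D' + E) / 2 * 1"
        using E pos ab by (intro mult_left_mono) auto
      finally have "2 * \<bar>\<psi> a b - \<psi> a 1\<bar> \<le> D' + E" by simp
      moreover have "\<bar>\<psi> a 1\<bar> \<le> B"
      proof -
        have "area (1 - a) \<le> area (1 + U0)" using ab by (intro area_mono) auto
        then have "D * area (1 - a) * (1 + area (1 - a)) \<le> B"
          unfolding B_def using assms area_pos[of "1 - a"] area_pos[of "1 + U0"] by (intro mult_mono) auto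
        then show ?thesis using char_waveD(5)[OF w, of a] ab by linarith
      qed
      ultimately have "E \<le> 2 * B + D'" using E by (smt (verit))
      then have "W \<le> (2 * B + D') * exp (- (L * a))"
        by (simp add: E_def exp_minus field_simps)
      also have "\<dots> \<le> W0"
        using pos ab mult_left_mono[of "- a" U0 L] by (auto simp: W0_def intro!: mult_left_mono)
      finally show ?thesis .
    qed
    then have "W * exp (L * u) \<le> W0 * exp (L * U1)"
      using pos u by (intro mult_mono) auto
    moreover from this have "(D' + W * exp (L * u)) / v ^ 3 \<le> C / v ^ 3"
      using v by (intro divide_right_mono) (auto simp: C_def)
    ultimately show ?thesis
      using psi[OF u v] g[OF u v] by (auto simp: C_def)
  qed
  have "0 \<le> W0 * exp (L * U1)" using pos by simp
  then have "0 < C" unfolding C_def by (simp add: less_max_iff_disj add_nonneg_pos max_def)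
  with main show ?thesis by blast
qed

section \<open>Decay outside the curve of radius \<open>R1\<close>\<close>

abbreviation X1 :: real where "X1 \<equiv> r_star M e R1"

lemma area_ge_R1: "X1 \<le> x \<Longrightarrow> R1 + (x - X1) / 2 \<le> area x"
  using M_pos by (intro area_lower) auto

lemma area_X1: "area X1 = R1"
  using r_plus_le M_pos by (intro area_r_star) auto

text \<open>For \<open>2 * u \<le> v\<close> the radius is comparable to \<open>v\<close>, and the
  \<open>u^(-2)\<close> bound is used. Otherwise \<open>u\<close> is comparable to \<open>v\<close>,
  and the factor \<open>r\<close> in the second bound lowers \<open>r^(-3)\<close> to the integrable
  \<open>r^(-2)\<close>.\<close>

lemma source_bound:
  assumes "1 \<le> u" "8 * \<bar>X1\<bar> \<le> u" "X1 \<le> v - u" "0 \<le> A"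
    and psi: "\<bar>y\<bar> \<le> A / u\<^sup>2" "\<bar>y\<bar> \<le> A * area (v - u) / u ^ 3"
  shows "pot (area (v - u)) * \<bar>y\<bar> \<le> (1024 * M * A / u\<^sup>2 + 16 * M * A / (area (v - u))\<^sup>2) / v ^ 3"
proof -
  define r where "r = area (v - u)"
  have r: "0 < r" "R1 + (v - u - X1) / 2 \<le> r"
    using area_pos area_ge_R1[OF assms(3)] by (auto simp: r_def)
  have v: "0 < v" "4 * X1 \<le> v" using assms by (auto simp: abs_if split: if_splits)
  have pot: "0 \<le> pot r" "pot r \<le> 2 * M / r ^ 3"
    using pot_bounds[OF area_gt] by (auto simp: r_def)
  show ?thesis
  proof (cases "2 * u \<le> v")
    case True
    \<comment> \<open>Here \<open>u \<le> v / 2\<close> and \<open>X1 \<le> v / 4\<close> leave at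
      least \<open>v / 4\<close> for \<open>v - u - X1\<close>.\<close>
    then have "v / 8 \<le> r" using r v M_pos by argo
    then have "2 * M / r ^ 3 \<le> 2 * M / (v / 8) ^ 3"
      using v M_pos r by (intro divide_left_mono power_mono mult_pos_pos) auto
    then have "pot r \<le> 1024 * M / v ^ 3" using pot by (simp add: power_divide)
    then have "pot r * \<bar>y\<bar> \<le> 1024 * M / v ^ 3 * (A / u\<^sup>2)"
      using psi pot M_pos v by (intro mult_mono) auto
    also have "\<dots> = 1024 * M * A / u\<^sup>2 / v ^ 3" by simp
    also have "\<dots> \<le> (1024 * M * A / u\<^sup>2 + 16 * M * A / r\<^sup>2) / v ^ 3"
      using v M_pos assms by (intro divide_right_mono) auto
    finally show ?thesis by (simp add: r_def)
  next
    case False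
    have "pot r * \<bar>y\<bar> \<le> 2 * M / r ^ 3 * (A * r / u ^ 3)"
      using psi pot M_pos r by (intro mult_mono) (auto simp: r_def)
    also have "\<dots> = 2 * M * A / r\<^sup>2 * (1 / u ^ 3)"
      using r by (simp add: power2_eq_square power3_eq_cube)
    also have "\<dots> \<le> 2 * M * A / r\<^sup>2 * (8 / v ^ 3)"
    proof -
      have "v ^ 3 \<le> (2 * u) ^ 3" using False v by (intro power_mono) auto
      then have "1 / u ^ 3 \<le> 8 / v ^ 3" using v assms by (simp add: field_simps)
      then show ?thesis using M_pos assms by (intro mult_left_mono) auto
    qed
    also have "\<dots> = 16 * M * A / r\<^sup>2 / v ^ 3" by simp
    also have "\<dots> \<le> (1024 * M * A / u\<^sup>2 + 16 * M * A / r\<^sup>2) / v ^ 3"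
      using v M_pos assms by (intro divide_right_mono) auto
    finally show ?thesis by (simp add: r_def)
  qed
qed

text \<open>\<open>source_bound\<close> integrated in \<open>u\<close>. Both terms are small once
  the starting value \<open>a\<close> and the final radius \<open>area (v - b)\<close> are
  large.\<close>

lemma far_g_diff:
  assumes w: "char_wave U0 D A' \<psi> g"
    and "0 \<le> U0" "1 \<le> a" "8 * \<bar>X1\<bar> \<le> a" "a \<le> b" "X1 \<le> v - b" "1 \<le> v" "0 \<le> A"
    and psi: "\<And>u. a \<le> u \<Longrightarrow> u \<le> b \<Longrightarrow> \<bar>\<psi> u v\<bar> \<le> A / u\<^sup>2 \<and> \<bar>\<psi> u v\<bar> \<le> A * area (v - u) / u ^ 3"
  shows "\<bar>g b v - g a v\<bar> \<le> (1024 * M * A / a + 32 * M * A / area (v - b)) / v ^ 3"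
proof -
  \<comment> \<open>The \<open>u\<close>-derivative of \<open>1 / area (v - u)\<close> is the lapse
    over the squared radius. As the lapse is at least 1/2 here, doubling 16 to 32 covers the
    source.\<close>
  define h where "h = (\<lambda>u. (- (1024 * M * A) / u + 32 * M * A / area (v - u)) / v ^ 3)"
  have "\<bar>g b v - g a v\<bar> \<le> h b - h a"
  proof (rule g_diff_le[OF w])
    fix u assume u: "a \<le> u" "u \<le> b"
    have u0: "0 < u" using u assms by linarith
    define r where "r = area (v - u)"
    have r: "0 < r" using area_pos by (simp add: r_def)
    show "(h has_real_derivative
        (1024 * M * A / u\<^sup>2 + 32 * M * A * lapse (area (v - u)) / (area (v - u))\<^sup>2) / v ^ 3) (at u)"
    proof -
      have "((\<lambda>u. area (v - u)) has_real_derivative lapse (area (v - u)) * -1) (at u)"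
        by (rule DERIV_chain2[OF DERIV_area]) (auto intro!: derivative_eq_intros)
      then show ?thesis
        unfolding h_def using u0 r[unfolded r_def]
        by (intro DERIV_cdivide) (auto intro!: derivative_eq_intros simp: power2_eq_square)
    qed
    have "R1 \<le> r" using area_ge_R1[of "v - u"] u assms unfolding r_def by argo
    then have "1 / 2 \<le> lapse r" using M_pos by (intro lapse_ge) auto
    then have "16 * M * A * 1 \<le> 16 * M * A * (2 * lapse r)"
      using M_pos assms by (intro mult_left_mono) auto
    then have "16 * M * A / r\<^sup>2 \<le> 32 * M * A * lapse r / r\<^sup>2"
      by (intro divide_right_mono) auto
    then have "(1024 * M * A / u\<^sup>2 + 16 * M * A / r\<^sup>2) / v ^ 3 \<le>
        (1024 * M * A / u\<^sup>2 + 32 * M * A * lapse r / r\<^sup>2) / v ^ 3"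
      using assms by (intro divide_right_mono) auto
    then show "pot (area (v - u)) * \<bar>\<psi> u v\<bar> \<le>
        (1024 * M * A / u\<^sup>2 + 32 * M * A * lapse (area (v - u)) / (area (v - u))\<^sup>2) / v ^ 3"
      using source_bound[of u v A "\<psi> u v"] psi[OF u] u assms unfolding r_def by argo
  qed (use assms in auto)
  also have "h b - h a = (- (1024 * M * A) / b + 32 * M * A / area (v - b)
      + 1024 * M * A / a - 32 * M * A / area (v - a)) / v ^ 3"
    by (simp add: h_def diff_divide_distrib add_divide_distrib)
  also have "\<dots> \<le> (1024 * M * A / a + 32 * M * A / area (v - b)) / v ^ 3"
  proof (rule divide_right_mono)
    have "0 \<le> 1024 * M * A / b" "0 \<le> 32 * M * A / area (v - a)"
      using assms M_pos area_pos[of "v - a"] by auto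
    then show "- (1024 * M * A) / b + 32 * M * A / area (v - b) + 1024 * M * A / a
        - 32 * M * A / area (v - a) \<le> 1024 * M * A / a + 32 * M * A / area (v - b)"
      by simp
  qed (use assms in auto)
  finally show ?thesis .
qed

text \<open>
  The largest constant \<open>A\<close> for which the claimed decay holds on a compact part of the far region
  satisfies \<open>A \<le> A\<^sub>0 + A / 2\<close>, because the source term contributes only the small factors
  \<open>M / U1\<close> and \<open>M / R1\<close>.
\<close>

lemma far_bound:
  assumes "0 \<le> D" "0 \<le> U0" "0 \<le> A'"
  shows "\<exists>U1 A. 1 \<le> U1 \<and> 8 * \<bar>X1\<bar> \<le> U1 \<and> 0 < A \<and> (\<forall>\<psi> g. char_wave U0 D A' \<psi> g \<longrightarrow>
    (\<forall>u v. U1 \<le> u \<longrightarrow> X1 \<le> v - u \<longrightarrow>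
       \<bar>\<psi> u v\<bar> \<le> A / u\<^sup>2 \<and> \<bar>\<psi> u v\<bar> \<le> A * area (v - u) / u ^ 3))"
proof -
  \<comment> \<open>The summand \<open>65536 * M\<close>, with \<open>65536 = 1024 * 64\<close>,
    makes the first error term at most \<open>W / 64\<close>; the rest ensures that
    \<open>a + X1\<close> is at least both \<open>a / 2\<close> and 1 when
    \<open>U1 \<le> a\<close>.\<close>
  define U1 where "U1 = 8 * \<bar>X1\<bar> + 2 + 65536 * M"
  have U1: "2 \<le> U1" "8 * \<bar>X1\<bar> \<le> U1" "65536 * M \<le> U1" using M_pos by (auto simp: U1_def)
  have "- U0 \<le> U1" using assms U1 by linarith
  from near_bound[OF assms(1) this assms(2), of A']
  obtain C where C: "0 < C" and near: "\<And>\<psi> g u v. char_wave U0 D A' \<psi> g \<Longrightarrow> - U0 \<le> u \<Longrightarrow> u \<le> U1 \<Longrightarrow>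
      1 \<le> v \<Longrightarrow> \<bar>\<psi> u v\<bar> \<le> C \<and> \<bar>g u v\<bar> \<le> C / v ^ 3"
    by blast
  \<comment> \<open>The estimate below reads
    \<open>W \<le> A' + A' / R1 + 16 * (C + W / 32)\<close>; solving it for \<open>W\<close> gives
    this value.\<close>
  define A where "A = 2 * (A' + A' / R1 + 16 * C)"
  have "0 \<le> A' / R1" using assms M_pos by simp
  then have A: "0 < A" using C assms unfolding A_def by argo
  have main: "\<bar>\<psi> u v\<bar> \<le> A / u\<^sup>2 \<and> \<bar>\<psi> u v\<bar> \<le> A * area (v - u) / u ^ 3"
    if w: "char_wave U0 D A' \<psi> g" and u: "U1 \<le> u" and v: "X1 \<le> v - u" for \<psi> g u v
  proof -
    \<comment> \<open>A compact triangle. With each of its points it contains the segment in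
      \<open>u\<close> back to \<open>U1\<close> and the segment in \<open>v\<close> back to the
      curve \<open>r = R1\<close>.\<close>
    define S where "S = {(a, b). U1 \<le> a \<and> X1 \<le> b - a \<and> b \<le> v}"
    \<comment> \<open>The maximum of the two reciprocal decay rates encodes both bounds in a single
      supremum.\<close>
    define q where "q = (\<lambda>(u, v). \<bar>\<psi> u v\<bar> * max (u\<^sup>2) (u ^ 3 / area (v - u)))"
    have S: "U1 \<le> a" "X1 \<le> b - a" "b \<le> v" "a / 2 \<le> a + X1" "1 \<le> a + X1" "1 \<le> b" if "(a, b) \<in> S" for a b
    proof -
      have *: "U1 \<le> a" "X1 \<le> b - a" "b \<le> v" using that by (auto simp: S_def)
      have "- X1 \<le> \<bar>X1\<bar>" by simp
      then have "- X1 \<le> a / 2" "1 \<le> a / 2" using * U1 by argo+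
      then show "U1 \<le> a" "X1 \<le> b - a" "b \<le> v" "a / 2 \<le> a + X1" "1 \<le> a + X1" "1 \<le> b"
        using * by simp_all
    qed
    have "compact S"
    proof -
      have "S \<subseteq> {U1..v - X1} \<times> {1..v}"
      proof clarify
        fix a b assume "(a, b) \<in> S"
        note s = S[OF this]
        then show "a \<in> {U1..v - X1} \<and> b \<in> {1..v}" by simp
      qed
      then have "bounded S" by (rule bounded_subset[rotated]) (intro bounded_Times bounded_closed_interval)
      moreover have "closed S"
        unfolding S_def case_prod_beta by (intro closed_Collect_conj closed_Collect_le continuous_intros)
      ultimately show ?thesis by (simp add: compact_eq_bounded_closed)
    qed
    moreover have "(u, v) \<in> S" using u v by (simp add: S_def)
    moreover have "continuous_on S q"
    proof -
      have "S \<subseteq> {- U0..} \<times> {1..}"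
      proof clarify
        fix a b assume "(a, b) \<in> S"
        note s = S[OF this]
        then show "a \<in> {- U0..} \<and> b \<in> {1..}" using U1 assms by simp
      qed
      then have "continuous_on S (\<lambda>(u, v). \<psi> u v)"
        by (rule continuous_on_subset[OF char_waveD(1)[OF w]])
      moreover have "continuous_on S (\<lambda>p. area (snd p - fst p))"
        by (rule continuous_on_compose2[OF continuous_on_area]) (auto intro!: continuous_intros)
      ultimately show ?thesis
        unfolding q_def case_prod_beta
        by (intro continuous_intros) (use area_pos in \<open>auto simp: less_imp_neq[symmetric]\<close>)
    qed
    ultimately obtain p where p: "p \<in> S" and sup: "\<forall>y\<in>S. q y \<le> q p"
      using continuous_attains_sup[of S q] by blast
    define W where "W = q p"
    have W0: "0 \<le> W" by (auto simp: W_def q_def case_prod_beta le_max_iff_disj)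
    have psi: "\<bar>\<psi> a b\<bar> \<le> W / a\<^sup>2 \<and> \<bar>\<psi> a b\<bar> \<le> W * area (b - a) / a ^ 3" if "(a, b) \<in> S" for a b
    proof -
      have pos: "0 < a" "0 < area (b - a)" using S[OF that] U1 area_pos by auto
      have "\<bar>\<psi> a b\<bar> * max (a\<^sup>2) (a ^ 3 / area (b - a)) \<le> W" using sup that by (force simp: W_def q_def)
      then have "\<bar>\<psi> a b\<bar> * a\<^sup>2 \<le> W" "\<bar>\<psi> a b\<bar> * (a ^ 3 / area (b - a)) \<le> W"
        by (meson abs_ge_zero max.cobounded1 max.cobounded2 mult_left_mono order_trans)+
      then show ?thesis using pos by (simp add: field_simps)
    qed
    have g: "\<bar>g a b\<bar> \<le> (C + W / 32) / b ^ 3" if ab: "(a, b) \<in> S" for a b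
    proof -
      have "\<bar>g a b - g U1 b\<bar> \<le> (1024 * M * W / U1 + 32 * M * W / area (b - a)) / b ^ 3"
      proof (rule far_g_diff[OF w])
        fix x assume "U1 \<le> x" "x \<le> a"
        then have "(x, b) \<in> S" using ab by (auto simp: S_def)
        then show "\<bar>\<psi> x b\<bar> \<le> W / x\<^sup>2 \<and> \<bar>\<psi> x b\<bar> \<le> W * area (b - x) / x ^ 3" by (rule psi)
      qed (use S[OF ab] U1 W0 assms in auto)
      also have "\<dots> \<le> (W / 64 + W / 64) / b ^ 3"
      proof (intro divide_right_mono add_mono)
        have "65536 * M * W \<le> U1 * W" using U1 W0 by (intro mult_right_mono) auto
        then show "1024 * M * W / U1 \<le> W / 64" using U1 by (simp add: field_simps)
        have "R1 \<le> area (b - a)" using area_ge_R1[of "b - a"] S[OF ab] by argo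
        then have "R1 * W \<le> area (b - a) * W" using W0 by (intro mult_right_mono) auto
        then show "32 * M * W / area (b - a) \<le> W / 64" using area_pos[of "b - a"] by (simp add: field_simps)
      qed (use S[OF ab] in auto)
      finally have "\<bar>g a b - g U1 b\<bar> \<le> (W / 32) / b ^ 3" by simp
      moreover have "\<bar>g U1 b\<bar> \<le> C / b ^ 3" using near[OF w, of U1 b] S[OF ab] U1 assms by auto
      ultimately show ?thesis unfolding add_divide_distrib[of C] by linarith
    qed
    have "W \<le> A"
    proof -
      obtain a b where ab: "p = (a, b)" "(a, b) \<in> S" using p by (cases p) auto
      define r where "r = area (b - a)"
      define K' where "K' = C + W / 32"
      have K': "0 \<le> K'" using C W0 by (simp add: K'_def)
      note s = S[OF ab(2)]
      have a: "2 \<le> a" using s U1 by linarith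
      have r: "R1 + (b - a - X1) / 2 \<le> r" using area_ge_R1[of "b - a"] s by (simp add: r_def)
      then have r': "R1 \<le> r" "b - (a + X1) \<le> 2 * r" "0 < r" using s M_pos by argo+
      have gb: "\<bar>g a b'\<bar> \<le> K' / b' ^ 3" if "a + X1 \<le> b'" "b' \<le> b" for b'
        unfolding K'_def using that s by (intro g) (auto simp: S_def)
      \<comment> \<open>The starting point of the integration in \<open>v\<close> lies on
        \<open>r = R1\<close>, where the decay hypothesis applies.\<close>
      have bdry: "\<bar>\<psi> a (a + X1)\<bar> \<le> A' / a ^ 3"
        using s a by (intro char_waveD(6)[OF w]) (auto simp: area_X1)
      have "\<bar>\<psi> a b - \<psi> a (a + X1)\<bar> \<le> K' / 2 * (1 / (a + X1)\<^sup>2 - 1 / b\<^sup>2)"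
        using s a assms gb by (intro psi_diff_le(1)[OF w]) auto
      also have "\<dots> \<le> K' / 2 * (1 / (a / 2)\<^sup>2)"
      proof (intro mult_left_mono)
        have "1 / (a + X1)\<^sup>2 \<le> 1 / (a / 2)\<^sup>2"
          using s a by (intro divide_left_mono power_mono mult_pos_pos) auto
        then show "1 / (a + X1)\<^sup>2 - 1 / b\<^sup>2 \<le> 1 / (a / 2)\<^sup>2"
          using zero_le_power2[of b] by (smt (verit) zero_le_divide_1_iff)
      qed (use K' in auto)
      finally have "\<bar>\<psi> a b\<bar> \<le> A' / a ^ 3 + 2 * K' / a\<^sup>2"
        using bdry by (simp add: power_divide)
      then have "\<bar>\<psi> a b\<bar> * a\<^sup>2 \<le> (A' / a ^ 3 + 2 * K' / a\<^sup>2) * a\<^sup>2"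
        by (intro mult_right_mono) auto
      also have "\<dots> = A' / a + 2 * K'"
        using a by (simp add: field_simps power2_eq_square power3_eq_cube)
      also have "\<dots> \<le> A' / 1 + 16 * K'"
        using a assms K' by (intro add_mono divide_left_mono) auto
      finally have 1: "\<bar>\<psi> a b\<bar> * a\<^sup>2 \<le> A' + 16 * K'" by simp
      \<comment> \<open>For the second weight the length of the segment, at most
        \<open>2 * r\<close>, supplies the factor \<open>r\<close>.\<close>
      have "\<bar>\<psi> a b - \<psi> a (a + X1)\<bar> \<le> K' / (a + X1) ^ 3 * (b - (a + X1))"
        using s a assms gb by (intro psi_diff_le(2)[OF w]) auto
      also have "\<dots> \<le> K' / (a / 2) ^ 3 * (2 * r)"
        using s a r' K' by (intro mult_mono divide_left_mono power_mono mult_pos_pos) auto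
      finally have "\<bar>\<psi> a b\<bar> \<le> A' / a ^ 3 + 16 * K' * r / a ^ 3"
        using bdry by (simp add: power_divide)
      then have "\<bar>\<psi> a b\<bar> * (a ^ 3 / r) \<le> (A' / a ^ 3 + 16 * K' * r / a ^ 3) * (a ^ 3 / r)"
        using a r' by (intro mult_right_mono) auto
      also have "\<dots> = A' / r + 16 * K'"
        using a r' by (simp add: field_simps)
      also have "\<dots> \<le> A' / R1 + 16 * K'"
        using r' assms M_pos by (intro add_mono divide_left_mono) auto
      finally have 2: "\<bar>\<psi> a b\<bar> * (a ^ 3 / r) \<le> A' / R1 + 16 * K'" .
      have "0 \<le> A' / R1" using assms M_pos by simp
      moreover have "W = \<bar>\<psi> a b\<bar> * max (a\<^sup>2) (a ^ 3 / r)" by (simp add: W_def q_def ab r_def)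
      ultimately have "W \<le> A' + A' / R1 + 16 * K'" using 1 2 assms unfolding max_def by (auto split: if_splits)
      then show ?thesis unfolding A_def K'_def by argo
    qed
    have uv: "(u, v) \<in> S" by fact
    have pos: "0 < u" "0 < area (v - u)" using S[OF uv] U1 area_pos by auto
    have "W / u\<^sup>2 \<le> A / u\<^sup>2" "W * area (v - u) / u ^ 3 \<le> A * area (v - u) / u ^ 3"
      using \<open>W \<le> A\<close> pos by (auto intro!: divide_right_mono mult_right_mono)
    then show ?thesis using psi[OF uv] by linarith
  qed
  show ?thesis using main A U1
    by (intro exI[of _ U1] exI[of _ A]) auto
qed

section \<open>The radiation field and the lower bound\<close>

text \<open>With \<open>x = v - u\<close> the quantity splits into \<open>(v / x)^3\<close> and
  \<open>x^3\<close> times the potential. The latter tends to \<open>2 * M\<close>, and the former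
  is squeezed between its values at the two ends of the \<open>u\<close>-interval.\<close>

lemma pot_uniform:
  assumes "0 < \<epsilon>" "0 \<le> U0" "0 \<le> U2"
  shows "\<forall>\<^sub>F v in at_top. \<forall>u\<in>{- U0..U2}. \<bar>v ^ 3 * pot (area (v - u)) - 2 * M\<bar> \<le> \<epsilon>"
proof -
  define P where "P x = x ^ 3 * pot (area x)" for x
  \<comment> \<open>Chosen so that the error from \<open>(v / x)^3\<close> costs
    \<open>\<epsilon> / 2\<close>, given that \<open>P x\<close> is at most
    \<open>2 * M + \<epsilon>\<close>.\<close>
  define \<eta> where "\<eta> = \<epsilon> / (2 * (2 * M + \<epsilon>))"
  have \<eta>: "0 < \<eta>" "\<eta> * (2 * M + \<epsilon>) = \<epsilon> / 2"
    using assms M_pos by (auto simp: \<eta>_def field_simps)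
  have "((\<lambda>x. (x / area x) ^ 3 * (area x ^ 3 * pot (area x))) \<longlongrightarrow> 1 ^ 3 * (2 * M)) at_top"
    by (intro tendsto_mult tendsto_power area_asymp filterlim_compose[OF pot_asymp filterlim_area])
  moreover have "(\<lambda>x. (x / area x) ^ 3 * (area x ^ 3 * pot (area x))) = P"
    using area_pos by (intro ext) (simp add: P_def power_divide less_imp_neq[symmetric])
  ultimately have "(P \<longlongrightarrow> 2 * M) at_top" by simp
  then have "\<forall>\<^sub>F x in at_top. dist (P x) (2 * M) < \<epsilon> / 2"
    by (rule tendstoD) (use assms in simp)
  then obtain N where N: "\<And>x. N \<le> x \<Longrightarrow> \<bar>P x - 2 * M\<bar> < \<epsilon> / 2"
    by (auto simp: eventually_at_top_linorder dist_real_def)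
  have "((\<lambda>v. (v / (v + U0)) ^ 3) \<longlongrightarrow> 1) at_top" by real_asymp
  then have 1: "\<forall>\<^sub>F v in at_top. 1 - \<eta> < (v / (v + U0)) ^ 3"
    using \<eta> by (intro order_tendstoD) auto
  have "((\<lambda>v. (v / (v - U2)) ^ 3) \<longlongrightarrow> 1) at_top" by real_asymp
  then have 2: "\<forall>\<^sub>F v in at_top. (v / (v - U2)) ^ 3 < 1 + \<eta>"
    using \<eta> by (intro order_tendstoD) auto
  show ?thesis
    using 1 2 eventually_ge_at_top[of "N + U2"] eventually_gt_at_top[of U2]
  proof eventually_elim
    case (elim v)
    show ?case
    proof
      fix u assume u: "u \<in> {- U0..U2}"
      define x where "x = v - u"
      define m where "m = (v / x) ^ 3"
      have x: "0 < x" "N \<le> x" "0 < v" "v - U2 \<le> x" "x \<le> v + U0" using u elim assms by (auto simp: x_def)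
      have "(v / (v + U0)) ^ 3 \<le> m" "m \<le> (v / (v - U2)) ^ 3"
        unfolding m_def using x elim assms by (intro power_mono divide_left_mono mult_pos_pos; simp)+
      then have m: "\<bar>m - 1\<bar> \<le> \<eta>" using elim by linarith
      have p: "\<bar>P x - 2 * M\<bar> \<le> \<epsilon> / 2" "\<bar>P x\<bar> \<le> 2 * M + \<epsilon>" using N[OF x(2)] M_pos assms by linarith+
      have "\<bar>(m - 1) * P x\<bar> \<le> \<eta> * (2 * M + \<epsilon>)"
        unfolding abs_mult using m p \<eta> by (intro mult_mono) auto
      then have "\<bar>(m - 1) * P x + (P x - 2 * M)\<bar> \<le> \<epsilon>"
        using p(1) \<eta>(2) by linarith
      moreover have "v ^ 3 * pot (area x) = m * P x"
        using x by (simp add: m_def P_def power_divide)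
      ultimately show "\<bar>v ^ 3 * pot (area (v - u)) - 2 * M\<bar> \<le> \<epsilon>"
        unfolding x_def[symmetric] by (simp add: algebra_simps)
    qed
  qed
qed

text \<open>The radiation field in terms of \<psi> alone; for \<open>rphi_ext M e \<phi>\<close> in
  place of \<psi> it agrees with \<open>rad_field M e \<phi>\<close>.\<close>

definition rad :: "(real \<Rightarrow> real \<Rightarrow> real) \<Rightarrow> real \<Rightarrow> real" where
  "rad \<psi> u = Lim at_top (\<psi> u)"

lemma rad_bound:
  assumes w: "char_wave U0 D A' \<psi> g" and u: "- U0 \<le> u"
    and g: "\<And>v. 1 \<le> v \<Longrightarrow> \<bar>g u v\<bar> \<le> C / v ^ 3" and C: "0 \<le> C"
  shows "(\<psi> u \<longlongrightarrow> rad \<psi> u) at_top" "1 \<le> v \<Longrightarrow> \<bar>\<psi> u v - rad \<psi> u\<bar> \<le> C / (2 * v\<^sup>2)"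
proof -
  have le: "\<bar>\<psi> u b - \<psi> u a\<bar> \<le> C / (2 * a\<^sup>2)" if "1 \<le> a" "a \<le> b" for a b
  proof -
    have "\<bar>\<psi> u b - \<psi> u a\<bar> \<le> C / 2 * (1 / a\<^sup>2 - 1 / b\<^sup>2)"
      using that g by (intro psi_diff_le(1)[OF w u]) auto
    also have "\<dots> \<le> C / 2 * (1 / a\<^sup>2)" using C by (intro mult_left_mono) auto
    finally show ?thesis by simp
  qed
  have lim: "((\<lambda>a. C / (2 * a\<^sup>2)) \<longlongrightarrow> 0) at_top" by real_asymp
  show "(\<psi> u \<longlongrightarrow> rad \<psi> u) at_top" "1 \<le> v \<Longrightarrow> \<bar>\<psi> u v - rad \<psi> u\<bar> \<le> C / (2 * v\<^sup>2)"
    unfolding rad_def using tendsto_of_diff_bound[of 1 "\<psi> u" "\<lambda>a. C / (2 * a\<^sup>2)"] le lim by auto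
qed

text \<open>On compact \<open>u\<close>-intervals the constant of \<open>near_bound\<close> is
  uniform, so \<psi> converges uniformly to its radiation field. Continuity serves the fundamental
  theorem of calculus and the integrability of the tail.\<close>

lemma continuous_on_rad:
  assumes w: "char_wave U0 D A' \<psi> g" and "0 \<le> D" "0 \<le> U0"
  shows "continuous_on {- U0..} (rad \<psi>)"
proof -
  have cont: "continuous_on {- U0..b} (rad \<psi>)" if b: "- U0 \<le> b" for b
  proof -
    obtain C where C: "0 < C" and g: "\<And>u v. - U0 \<le> u \<Longrightarrow> u \<le> b \<Longrightarrow> 1 \<le> v \<Longrightarrow> \<bar>g u v\<bar> \<le> C / v ^ 3"
      using near_bound[OF assms(2) b assms(3), of A'] w by blast
    show ?thesis
    proof (rule uniform_limit_theorem)
      show "\<forall>\<^sub>F v in at_top. continuous_on {- U0..b} (\<lambda>u. \<psi> u v)"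
        using eventually_ge_at_top[of 1]
      proof eventually_elim
        case (elim v)
        have "continuous_on {- U0..b} (\<lambda>u. (u, v))" by (intro continuous_intros)
        moreover have "(\<lambda>u. (u, v)) ` {- U0..b} \<subseteq> {- U0..} \<times> {1..}" using elim by auto
        ultimately show ?case
          using continuous_on_compose2[OF char_waveD(1)[OF w]] by fastforce
      qed
      show "uniform_limit {- U0..b} (\<lambda>v u. \<psi> u v) (rad \<psi>) at_top"
      proof (rule uniform_limitI)
        fix \<epsilon> :: real assume \<epsilon>: "0 < \<epsilon>"
        have "((\<lambda>v. C / (2 * v\<^sup>2)) \<longlongrightarrow> 0) at_top" by real_asymp
        then have "\<forall>\<^sub>F v in at_top. C / (2 * v\<^sup>2) < \<epsilon>" using \<epsilon> by (rule order_tendstoD)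
        then show "\<forall>\<^sub>F v in at_top. \<forall>u\<in>{- U0..b}. dist (\<psi> u v) (rad \<psi> u) < \<epsilon>"
          using eventually_ge_at_top[of 1]
        proof eventually_elim
          case (elim v)
          show ?case
          proof
            fix u assume "u \<in> {- U0..b}"
            then have "\<bar>\<psi> u v - rad \<psi> u\<bar> \<le> C / (2 * v\<^sup>2)"
              using elim C g by (intro rad_bound(2)[OF w]) auto
            then show "dist (\<psi> u v) (rad \<psi> u) < \<epsilon>" using elim by (simp add: dist_real_def)
          qed
        qed
      qed
    qed simp
  qed
  \<comment> \<open>Continuity is local, so compact intervals reaching past \<open>x\<close>
    suffice.\<close>
  have "continuous (at x within {- U0..}) (rad \<psi>)" if "- U0 \<le> x" for x
  proof -
    have "continuous (at x within {- U0..x + 1}) (rad \<psi>)"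
      using cont[of "x + 1"] that by (simp add: continuous_on_eq_continuous_within)
    moreover have "at x within {- U0..x + 1} = at x within {- U0..}"
      by (rule at_within_nhd[where S = "{..<x + 1}"]) auto
    ultimately show ?thesis by simp
  qed
  then show ?thesis by (simp add: continuous_on_eq_continuous_within)
qed

text \<open>The order of quantifiers carries the uniformity: \<open>R\<close> depends on the
  constants only, and \<open>U\<close> also on the initial values \<open>f\<close> with their limit
  \<open>l\<close>, but not on the solution.\<close>

lemma char_wave_lower_bound:
  assumes "0 \<le> D" "0 \<le> U0" "0 \<le> A'" "L \<noteq> 0"
  shows "\<exists>R>R1. \<forall>f l. ((\<lambda>v. v ^ 3 * f v) \<longlongrightarrow> l) at_top \<longrightarrow> (\<exists>U. \<forall>\<psi> g.
    char_wave U0 D A' \<psi> g \<longrightarrow> (\<forall>v\<ge>1. g (- U0) v = f v) \<longrightarrow>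
    l - integral {- U0..} (\<lambda>u. 2 * M * rad \<psi> u) = L \<longrightarrow>
    (\<forall>u\<ge>U. \<forall>v. area (v - u) = R \<longrightarrow> 1 \<le> v \<and> \<bar>L\<bar> / 8 \<le> v ^ 3 * \<bar>g u v\<bar>))"
proof -
  obtain U1 A where U1: "1 \<le> U1" "8 * \<bar>X1\<bar> \<le> U1" and A: "0 < A"
    and far: "\<And>\<psi> g u v. char_wave U0 D A' \<psi> g \<Longrightarrow> U1 \<le> u \<Longrightarrow> X1 \<le> v - u \<Longrightarrow>
       \<bar>\<psi> u v\<bar> \<le> A / u\<^sup>2 \<and> \<bar>\<psi> u v\<bar> \<le> A * area (v - u) / u ^ 3"
    using far_bound[OF assms(1-3)] by blast
  \<comment> \<open>The errors below add up to \<open>6 * \<delta>\<close>, which leaves 26/32 of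
    \<bar>L\<bar>, more than the required eighth.\<close>
  define \<delta> where "\<delta> = \<bar>L\<bar> / 32"
  have \<delta>: "0 < \<delta>" using assms by (simp add: \<delta>_def)
  \<comment> \<open>\<open>R\<close> and \<open>U2\<close> are large enough that each of the two
    error terms of \<open>far_g_diff\<close> is at most \<delta>.\<close>
  define R where "R = R1 + 1 + 32 * M * A / \<delta>"
  define U2 where "U2 = U1 + 1024 * M * A / \<delta>"
  have nn: "0 \<le> 32 * M * A / \<delta>" "0 \<le> 1024 * M * A / \<delta>" using M_pos A \<delta> by auto
  have R: "R1 < R" "32 * M * A / R \<le> \<delta>"
  proof -
    show R: "R1 < R" using nn by (simp add: R_def)
    then have "0 < R" using M_pos by linarith
    moreover have "32 * M * A / \<delta> \<le> R" using M_pos by (simp add: R_def)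
    ultimately show "32 * M * A / R \<le> \<delta>" using \<delta> by (simp add: field_simps)
  qed
  have U2: "U1 \<le> U2" "1024 * M * A / U2 \<le> \<delta>" "2 * M * A / U2 \<le> \<delta>" "0 < U2" "1 \<le> U2"
  proof -
    show U2: "U1 \<le> U2" using nn by (simp add: U2_def)
    then show U2': "0 < U2" "1 \<le> U2" using U1 by linarith+
    have "1024 * M * A / \<delta> \<le> U2" using U1 by (simp add: U2_def)
    then show *: "1024 * M * A / U2 \<le> \<delta>" using U2' \<delta> by (simp add: field_simps)
    have "2 * M * A / U2 \<le> 1024 * M * A / U2" using M_pos A U2' by (intro divide_right_mono) auto
    then show "2 * M * A / U2 \<le> \<delta>" using * by linarith
  qed
  have "- U0 \<le> U2" using U2 assms by linarith
  from near_bound[OF assms(1) this assms(2), of A']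
  obtain C where C: "0 < C" and near: "\<And>\<psi> g u v. char_wave U0 D A' \<psi> g \<Longrightarrow> - U0 \<le> u \<Longrightarrow> u \<le> U2 \<Longrightarrow>
      1 \<le> v \<Longrightarrow> \<bar>\<psi> u v\<bar> \<le> C \<and> \<bar>g u v\<bar> \<le> C / v ^ 3"
    by blast
  \<comment> \<open>Replacing \<open>v^3\<close> times the potential by \<open>2 * M\<close> then
    costs at most \<delta> after integration over the \<open>u\<close>-interval up to
    \<open>U2\<close>.\<close>
  define \<epsilon> where "\<epsilon> = \<delta> / (C * (U2 + U0))"
  have \<epsilon>: "0 < \<epsilon>" "\<epsilon> * C * (U2 + U0) = \<delta>" using \<delta> C U2 assms by (auto simp: \<epsilon>_def)
  have main: "\<exists>U. \<forall>\<psi> g.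
    char_wave U0 D A' \<psi> g \<longrightarrow> (\<forall>v\<ge>1. g (- U0) v = f v) \<longrightarrow>
    l - integral {- U0..} (\<lambda>u. 2 * M * rad \<psi> u) = L \<longrightarrow>
    (\<forall>u\<ge>U. \<forall>v. area (v - u) = R \<longrightarrow> 1 \<le> v \<and> \<bar>L\<bar> / 8 \<le> v ^ 3 * \<bar>g u v\<bar>)"
    if lim: "((\<lambda>v. v ^ 3 * f v) \<longlongrightarrow> l) at_top" for f l
  proof -
    have 1: "\<forall>\<^sub>F v in at_top. dist (v ^ 3 * f v) l < \<delta>" using lim \<delta> by (rule tendstoD)
    have 2: "\<forall>\<^sub>F v in at_top. \<forall>u\<in>{- U0..U2}. \<bar>v ^ 3 * pot (area (v - u)) - 2 * M\<bar> \<le> \<epsilon>"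
      using pot_uniform \<epsilon> assms U2 by simp
    have "((\<lambda>v. M * C / v\<^sup>2 * (U2 + U0)) \<longlongrightarrow> 0) at_top" by real_asymp
    then have 3: "\<forall>\<^sub>F v in at_top. M * C / v\<^sup>2 * (U2 + U0) < \<delta>" using \<delta> by (rule order_tendstoD)
    have "\<forall>\<^sub>F v in at_top. \<bar>v ^ 3 * f v - l\<bar> < \<delta> \<and> 1 \<le> v \<and> M * C / v\<^sup>2 * (U2 + U0) < \<delta> \<and>
        (\<forall>u\<in>{- U0..U2}. \<bar>v ^ 3 * pot (area (v - u)) - 2 * M\<bar> \<le> \<epsilon>)"
      using 1 2 3 eventually_ge_at_top[of 1] by eventually_elim (simp add: dist_real_def)
    then obtain V where V: "\<And>v. V \<le> v \<Longrightarrow> \<bar>v ^ 3 * f v - l\<bar> < \<delta> \<and> 1 \<le> v \<and> M * C / v\<^sup>2 * (U2 + U0) < \<delta> \<and>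
        (\<forall>u\<in>{- U0..U2}. \<bar>v ^ 3 * pot (area (v - u)) - 2 * M\<bar> \<le> \<epsilon>)"
      unfolding eventually_at_top_linorder by blast
    \<comment> \<open>On \<open>r = R\<close> one has \<open>v = u + r_star M e R\<close>, so
      \<open>U \<le> u\<close> forces both \<open>U2 \<le> u\<close> and
      \<open>V \<le> v\<close>.\<close>
    define U where "U = max U2 (V - r_star M e R)"
    have "1 \<le> v \<and> \<bar>L\<bar> / 8 \<le> v ^ 3 * \<bar>g u v\<bar>"
      if w: "char_wave U0 D A' \<psi> g" and gf: "\<forall>v\<ge>1. g (- U0) v = f v"
        and L: "l - integral {- U0..} (\<lambda>u. 2 * M * rad \<psi> u) = L"
        and u: "U \<le> u" and v: "area (v - u) = R" for \<psi> g u v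
    proof -
      define \<Phi> where "\<Phi> = (\<lambda>u. 2 * M * rad \<psi> u)"
      have vu: "v - u = r_star M e R" using r_star_area[of "v - u"] v by simp
      have uv: "U2 \<le> u" "V \<le> v" using u vu by (auto simp: U_def)
      note V' = V[OF uv(2)]
      have v1: "1 \<le> v" "0 < v" using V' by auto
      have X: "X1 \<le> v - u"
        using r_star_strict_mono[OF _ R(1)] r_plus_le M_pos unfolding vu by force
      \<comment> \<open>The constant \<open>C\<close> only covers \<open>u\<close> up to
        \<open>U2\<close>; for convergence at a single \<open>x\<close>, \<open>near_bound\<close>
        is used again with \<open>x\<close> as the upper end.\<close>
      have lim_rad: "(\<psi> x \<longlongrightarrow> rad \<psi> x) at_top" if x: "- U0 \<le> x" for x
      proof -
        obtain C' where "0 < C'" "\<And>v. 1 \<le> v \<Longrightarrow> \<bar>g x v\<bar> \<le> C' / v ^ 3"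
          using near_bound[OF assms(1) x assms(2), of A'] w x by blast
        then show ?thesis using rad_bound(1)[OF w x, of C'] by auto
      qed
      \<comment> \<open>The far decay \<open>A / x^2\<close> is uniform in \<open>v\<close> and
        passes to the limit.\<close>
      have rad_dec: "\<bar>\<Phi> x\<bar> \<le> 2 * M * A / x\<^sup>2" if "U2 \<le> x" for x
      proof -
        have "\<forall>\<^sub>F y in at_top. \<bar>\<psi> x y\<bar> \<le> A / x\<^sup>2"
          using eventually_ge_at_top[of "x + X1"]
        proof eventually_elim
          case (elim y)
          then show ?case using far[OF w, of x y] that U2 by simp
        qed
        moreover have "((\<lambda>y. \<bar>\<psi> x y\<bar>) \<longlongrightarrow> \<bar>rad \<psi> x\<bar>) at_top"
          using that U2 assms by (intro tendsto_intros lim_rad) simp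
        ultimately have "\<bar>rad \<psi> x\<bar> \<le> A / x\<^sup>2" by (intro tendsto_upperbound) auto
        then have "2 * M * \<bar>rad \<psi> x\<bar> \<le> 2 * M * (A / x\<^sup>2)" using M_pos by (intro mult_left_mono) auto
        then show ?thesis using M_pos by (simp add: \<Phi>_def abs_mult)
      qed
      have cont: "continuous_on {- U0..} \<Phi>"
        unfolding \<Phi>_def by (intro continuous_intros continuous_on_rad[OF w]) (use assms in auto)
      then have cont': "continuous_on {- U0..U2} \<Phi>" "continuous_on {U2..} \<Phi>"
        by (rule continuous_on_subset; use U2 assms in force)+
      note tail = integral_inverse_square_tail[OF U2(4) cont'(2) rad_dec, simplified]
      have split: "integral {- U0..} \<Phi> = integral {- U0..U2} \<Phi> + integral {U2..} \<Phi>"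
      proof -
        have "{- U0..} = {- U0..U2} \<union> {U2..}" using U2 assms by auto
        moreover have "{- U0..U2} \<inter> {U2..} = {U2}" using U2 assms by auto
        ultimately show ?thesis
          using tail(1) integrable_continuous_real[OF cont'(1)] by (simp add: integral_Un)
      qed
      \<comment> \<open>\<open>T\<close> would be constant in \<open>x\<close> if \<open>v^3\<close>
        times the source were exactly \<open>\<Phi> x\<close>. Its variation measures the error of
        that replacement.\<close>
      define T where "T = (\<lambda>x. v ^ 3 * g x v + integral {- U0..x} \<Phi>)"
      have "\<bar>T U2 - T (- U0)\<bar> \<le> (\<epsilon> * C + M * C / v\<^sup>2) * U2 - (\<epsilon> * C + M * C / v\<^sup>2) * - U0"
      proof (rule abs_diff_le_of_deriv[where S = "{- U0..U2}" and f = T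
            and f' = "\<lambda>x. v ^ 3 * - (pot (area (v - x)) * \<psi> x v) + \<Phi> x"])
        fix x assume x: "- U0 \<le> x" "x \<le> U2"
        have "((\<lambda>x. g x v) has_real_derivative - (pot (area (v - x)) * \<psi> x v)) (at x within {- U0..U2})"
          by (rule DERIV_subset[OF char_waveD(3)[OF w]]) (use x v1 in auto)
        moreover have "((\<lambda>x. integral {- U0..x} \<Phi>) has_real_derivative \<Phi> x) (at x within {- U0..U2})"
          using cont'(1) x by (intro integral_has_real_derivative) auto
        ultimately show "(T has_real_derivative v ^ 3 * - (pot (area (v - x)) * \<psi> x v) + \<Phi> x)
            (at x within {- U0..U2})"
          unfolding T_def by (intro DERIV_add DERIV_cmult)
        show "((*) (\<epsilon> * C + M * C / v\<^sup>2) has_real_derivative \<epsilon> * C + M * C / v\<^sup>2)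
            (at x within {- U0..U2})"
          by (rule has_field_derivative_at_within[OF DERIV_cmult_Id])
        \<comment> \<open>The derivative of \<open>T\<close> splits into the error in the potential
          and the distance of \<psi> from its radiation field.\<close>
        have "\<bar>(v ^ 3 * pot (area (v - x)) - 2 * M) * \<psi> x v\<bar> \<le> \<epsilon> * C"
          unfolding abs_mult using V' near[OF w x v1(1)] x \<epsilon> by (intro mult_mono) auto
        moreover have "\<bar>2 * M * (\<psi> x v - rad \<psi> x)\<bar> \<le> M * C / v\<^sup>2"
        proof -
          have "\<bar>\<psi> x v - rad \<psi> x\<bar> \<le> C / (2 * v\<^sup>2)"
            using near[OF w x] x C v1 by (intro rad_bound(2)[OF w]) auto
          then have "2 * M * \<bar>\<psi> x v - rad \<psi> x\<bar> \<le> 2 * M * (C / (2 * v\<^sup>2))"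
            using M_pos by (intro mult_left_mono) auto
          then show ?thesis using M_pos by (simp add: abs_mult)
        qed
        moreover have "v ^ 3 * - (pot (area (v - x)) * \<psi> x v) + \<Phi> x
          = - ((v ^ 3 * pot (area (v - x)) - 2 * M) * \<psi> x v) - 2 * M * (\<psi> x v - rad \<psi> x)"
          by (simp add: \<Phi>_def algebra_simps)
        ultimately show "\<bar>v ^ 3 * - (pot (area (v - x)) * \<psi> x v) + \<Phi> x\<bar> \<le> \<epsilon> * C + M * C / v\<^sup>2"
          by linarith
      qed (use U2 assms in auto)
      also have "\<dots> = \<epsilon> * C * (U2 + U0) + M * C / v\<^sup>2 * (U2 + U0)"
        by (simp add: algebra_simps add_divide_distrib)
      also have "\<dots> \<le> \<delta> + \<delta>" using \<epsilon>(2) V' by linarith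
      finally have T: "\<bar>T U2 - T (- U0)\<bar> \<le> 2 * \<delta>" by simp
      have T0: "\<bar>T (- U0) - l\<bar> < \<delta>" using V' gf v1 by (simp add: T_def)
      have "\<bar>g u v - g U2 v\<bar> \<le> (1024 * M * A / U2 + 32 * M * A / area (v - u)) / v ^ 3"
      proof (rule far_g_diff[OF w])
        fix x assume x: "U2 \<le> x" "x \<le> u"
        show "\<bar>\<psi> x v\<bar> \<le> A / x\<^sup>2 \<and> \<bar>\<psi> x v\<bar> \<le> A * area (v - x) / x ^ 3"
          using x U2 X by (intro far[OF w]) auto
      qed (use U1 U2 A uv X v1 assms in auto)
      also have "\<dots> \<le> (\<delta> + \<delta>) / v ^ 3"
        unfolding v using U2 R v1 by (intro divide_right_mono add_mono) auto
      finally have "v ^ 3 * \<bar>g u v - g U2 v\<bar> \<le> 2 * \<delta>"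
        using v1 by (simp add: field_simps)
      then have G: "\<bar>v ^ 3 * g u v - v ^ 3 * g U2 v\<bar> \<le> 2 * \<delta>"
        using v1 by (simp flip: right_diff_distrib add: abs_mult)
      have "\<bar>integral {U2..} \<Phi>\<bar> \<le> \<delta>" using tail(2) U2(3) by linarith
      \<comment> \<open>Two \<delta> each from \<open>G\<close> and \<open>T\<close>, one from
        \<open>T0\<close>, and one from the tail of the integral.\<close>
      then have "\<bar>v ^ 3 * g u v - L\<bar> \<le> 6 * \<delta>"
        using T T0 G L split unfolding T_def \<Phi>_def[symmetric] by linarith
      then have "\<bar>L\<bar> - 6 * \<delta> \<le> \<bar>v ^ 3 * g u v\<bar>" by linarith
      then have "\<bar>L\<bar> / 8 \<le> \<bar>v ^ 3 * g u v\<bar>" by (simp add: \<delta>_def)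
      then show ?thesis using v1 by (simp add: abs_mult)
    qed
    then show ?thesis by blast
  qed
  then show ?thesis using R(1) by blast
qed

section \<open>Solutions of the wave equation\<close>

lemma r_ext_eq: "r_ext M e = (\<lambda>u v. area (v - u))"
  by (simp add: r_ext_def area_def fun_eq_iff)

lemma DERIV_r_ext:
  "((\<lambda>v. area (v - u)) has_real_derivative lapse (area (v - u))) (at v within S)"
  "((\<lambda>u. area (v - u)) has_real_derivative - lapse (area (v - u))) (at u within S)"
proof -
  have "((\<lambda>v. area (v - u)) has_real_derivative lapse (area (v - u)) * 1) (at v within S)"
    by (rule DERIV_chain2[OF DERIV_area]) (auto intro!: derivative_eq_intros)
  then show "((\<lambda>v. area (v - u)) has_real_derivative lapse (area (v - u))) (at v within S)"
    by simp
  have "((\<lambda>u. area (v - u)) has_real_derivative lapse (area (v - u)) * -1) (at u within S)"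
    by (rule DERIV_chain2[OF DERIV_area]) (auto intro!: derivative_eq_intros)
  then show "((\<lambda>u. area (v - u)) has_real_derivative - lapse (area (v - u))) (at u within S)"
    by simp
qed

lemma mem_region: "- U0 \<le> u \<Longrightarrow> 1 \<le> v \<Longrightarrow> (v, area (v - u)) \<in> region M e U0"
  unfolding region_def r_ext_eq by blast

text \<open>Chain rule along the map from \<open>(u, v)\<close> to \<open>(v, area (v - u))\<close>,
  which sends the null segments into \<open>region M e U0\<close>; hence derivatives within that set
  suffice.\<close>

lemma on_ext_derivs:
  assumes "C1_on (region M e U0) \<phi>" "- U0 \<le> u" "1 \<le> v"
  defines "f \<equiv> on_ext M e \<phi>"
  shows "((\<lambda>v'. f u v') has_real_derivative d_v f u v) (at v within {1..})"
    and "((\<lambda>u'. f u' v) has_real_derivative d_u {- U0..} f u v) (at u within {- U0..})"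
proof -
  obtain p q where pq: "\<And>x. x \<in> region M e U0 \<Longrightarrow>
      (\<phi> has_derivative (\<lambda>(h, k). p x * h + q x * k)) (at x within region M e U0)"
    using assms(1) unfolding C1_on_def by blast
  let ?x = "(v, area (v - u))" and ?l = "lapse (area (v - u))"
  have f: "f = (\<lambda>u v. \<phi> (v, area (v - u)))"
    by (simp add: f_def on_ext_def[abs_def] r_ext_eq)
  have "((\<lambda>v'. \<phi> (v', area (v' - u))) has_derivative
      (\<lambda>h. (\<lambda>(h, k). p ?x * h + q ?x * k) (h, ?l * h))) (at v within {1..})"
    using assms(2,3) mem_region DERIV_r_ext(1)[of u v "{1..}"]
    by (intro has_derivative_in_compose2[OF pq] has_derivative_Pair has_derivative_ident)
      (auto simp: has_field_derivative_def)
  then have dv: "((\<lambda>v'. f u v') has_real_derivative p ?x + q ?x * ?l) (at v within {1..})"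
    unfolding f has_field_derivative_def by (rule has_derivative_eq_rhs) (auto simp: algebra_simps)
  then show "((\<lambda>v'. f u v') has_real_derivative d_v f u v) (at v within {1..})"
    using d_v_eq[of v f u, OF assms(3) dv] by simp
  have "((\<lambda>u'. \<phi> (v, area (v - u'))) has_derivative
      (\<lambda>h. (\<lambda>(h, k). p ?x * h + q ?x * k) (0, - ?l * h))) (at u within {- U0..})"
    using assms(2,3) mem_region
    by (intro has_derivative_in_compose2[OF pq] has_derivative_Pair has_derivative_const
        DERIV_r_ext(2)[unfolded has_field_derivative_def]) auto
  then have du: "((\<lambda>u'. f u' v) has_real_derivative - (q ?x * ?l)) (at u within {- U0..})"
    unfolding f has_field_derivative_def by (rule has_derivative_eq_rhs) (auto simp: algebra_simps)
  then show "((\<lambda>u'. f u' v) has_real_derivative d_u {- U0..} f u v) (at u within {- U0..})"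
    using d_u_eq[of "- U0" u f v, OF assms(2) du] by simp
qed

lemma wave_solution_char_wave:
  assumes "wave_solution M e U0 \<phi>" "data_bounds M e U0 D \<phi>" "0 < D" "0 < U0"
    and R1_decay: "\<forall>u\<ge>1. \<forall>v\<ge>1. r_ext M e u v = R1 \<longrightarrow> u ^ 3 * \<bar>on_ext M e \<phi> u v\<bar> \<le> A'"
  shows "char_wave U0 D (R1 * A') (rphi_ext M e \<phi>) (d_v (rphi_ext M e \<phi>))"
proof -
  define f where "f = on_ext M e \<phi>"
  define \<psi> where "\<psi> = rphi_ext M e \<phi>"
  have C1: "C1_on (region M e U0) \<phi>" using assms(1) by (simp add: wave_solution_def)
  have r_app: "r_ext M e u v = area (v - u)" for u v by (simp add: r_ext_eq)
  note fv = on_ext_derivs(1)[OF C1, folded f_def] and fu = on_ext_derivs(2)[OF C1, folded f_def]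
  have psi: "\<psi> = (\<lambda>u v. area (v - u) * f u v)"
    by (simp add: \<psi>_def f_def rphi_ext_def[abs_def] r_ext_eq)
  have psi_v: "((\<lambda>v'. \<psi> u v') has_real_derivative lapse (area (v - u)) * f u v + area (v - u) * d_v f u v)
      (at v within {1..})" if "- U0 \<le> u" "1 \<le> v" for u v
    unfolding psi using DERIV_mult[OF DERIV_r_ext(1) fv[OF that]] by (simp add: algebra_simps)
  have dv_psi: "d_v \<psi> u v = lapse (area (v - u)) * f u v + area (v - u) * d_v f u v"
    if "- U0 \<le> u" "1 \<le> v" for u v
    by (rule d_v_eq[where f = \<psi>, OF that(2) psi_v[OF that]])
  have dv_r: "d_v (r_ext M e) u v = lapse (area (v - u))" if "1 \<le> v" for u v
    unfolding r_ext_eq by (intro d_v_eq that DERIV_r_ext(1))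
  have du_r: "d_u {- U0..} (r_ext M e) u v = - lapse (area (v - u))" if "- U0 \<le> u" for u v
    unfolding r_ext_eq by (intro d_u_eq that DERIV_r_ext(2))
  have du_psi: "d_u {- U0..} \<psi> u v = - lapse (area (v - u)) * f u v + area (v - u) * d_u {- U0..} f u v"
    if "- U0 \<le> u" "1 \<le> v" for u v
    unfolding psi using DERIV_mult[OF DERIV_r_ext(2) fu[OF that]]
    by (intro d_u_eq that) (simp add: algebra_simps)
  obtain w where w: "\<And>u v. - U0 \<le> u \<Longrightarrow> 1 \<le> v \<Longrightarrow>
        ((\<lambda>u'. d_v f u' v) has_real_derivative w u v) (at u within {- U0..})"
    and w_eq: "\<And>u v. - U0 \<le> u \<Longrightarrow> 1 \<le> v \<Longrightarrow> w u v =
        - (lapse (area (v - u)) * d_u {- U0..} f u v / area (v - u))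
        - - lapse (area (v - u)) * d_v f u v / area (v - u)"
  proof -
    from assms(1) obtain w where "\<forall>u\<in>{- U0..}. \<forall>v\<ge>1.
        ((\<lambda>u'. d_v f u' v) has_real_derivative w u v) (at u within {- U0..}) \<and>
        w u v = - (d_v (r_ext M e) u v * d_u {- U0..} f u v / r_ext M e u v)
          - d_u {- U0..} (r_ext M e) u v * d_v f u v / r_ext M e u v"
      unfolding wave_solution_def wave_eq_def f_def[symmetric] by blast
    note w = bspec[OF this, rule_format]
    have "((\<lambda>u'. d_v f u' v) has_real_derivative w u v) (at u within {- U0..}) \<and> w u v =
        - (lapse (area (v - u)) * d_u {- U0..} f u v / area (v - u))
        - - lapse (area (v - u)) * d_v f u v / area (v - u)" if u: "- U0 \<le> u" and v: "1 \<le> v" for u v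
      using w[of u v] u v unfolding dv_r[OF v] du_r[OF u] r_app atLeast_iff by blast
    then show ?thesis using that by blast
  qed
  \<comment> \<open>The wave equation cancels all first derivatives of \<open>f\<close>; what
    remains comes from differentiating the lapse.\<close>
  have g_u: "((\<lambda>u'. d_v \<psi> u' v) has_real_derivative - (pot (area (v - u)) * \<psi> u v)) (at u within {- U0..})"
    if u: "- U0 \<le> u" and v: "1 \<le> v" for u v
  proof -
    define r where "r = area (v - u)"
    define F' where "F' = 2 * (M - e\<^sup>2 / r) / r\<^sup>2"
    have r: "0 < r" using area_pos by (simp add: r_def)
    have "((\<lambda>u'. lapse (area (v - u'))) has_real_derivative F' * - lapse r) (at u within {- U0..})"
      using DERIV_chain2[OF DERIV_lapse DERIV_r_ext(2), of v u "{- U0..}"] area_pos[of "v - u"]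
      by (simp add: F'_def r_def)
    from DERIV_add[OF DERIV_mult[OF this fu[OF u v]] DERIV_mult[OF DERIV_r_ext(2) w[OF u v]]]
    have d: "((\<lambda>u'. lapse (area (v - u')) * f u' v + area (v - u') * d_v f u' v) has_real_derivative
        F' * - lapse r * f u v + d_u {- U0..} f u v * lapse r
        + (- lapse r * d_v f u v + w u v * r)) (at u within {- U0..})"
      by (simp add: r_def)
    have "w u v * r = - (lapse r * d_u {- U0..} f u v) + lapse r * d_v f u v"
      using r w_eq[OF u v] by (simp add: r_def[symmetric] field_simps)
    then have "F' * - lapse r * f u v + d_u {- U0..} f u v * lapse r
        + (- lapse r * d_v f u v + w u v * r) = - (F' * lapse r * f u v)"
      by (simp add: algebra_simps)
    also have "\<dots> = - (pot r * \<psi> u v)"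
      using r by (simp add: F'_def pot_def psi r_def[symmetric] power2_eq_square power3_eq_cube)
    finally have eq: "F' * - lapse r * f u v + d_u {- U0..} f u v * lapse r
        + (- lapse r * d_v f u v + w u v * r) = - (pot r * \<psi> u v)" .
    show ?thesis
      unfolding r_def[symmetric]
      by (rule has_field_derivative_transform_within[OF d[unfolded eq], of 1]) (use u v dv_psi in auto)
  qed
  have cont: "continuous_on ({- U0..} \<times> {1..}) (\<lambda>(u, v). \<psi> u v)"
  proof -
    obtain p q where "\<forall>x\<in>region M e U0.
        (\<phi> has_derivative (\<lambda>(h, k). p x * h + q x * k)) (at x within region M e U0)"
      using C1 unfolding C1_on_def by blast
    then have phi: "continuous_on (region M e U0) \<phi>"
      by (intro has_derivative_continuous_on) auto
    have a: "continuous_on ({- U0..} \<times> {1..}) (\<lambda>x. area (snd x - fst x))"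
      by (rule continuous_on_compose2[OF continuous_on_area]) (auto intro!: continuous_intros)
    have "continuous_on ({- U0..} \<times> {1..}) (\<lambda>x. \<phi> (snd x, area (snd x - fst x)))"
    proof (rule continuous_on_compose2[OF phi])
      show "continuous_on ({- U0..} \<times> {1..}) (\<lambda>x. (snd x, area (snd x - fst x)))"
        by (intro continuous_on_Pair a continuous_on_snd continuous_on_id)
      show "(\<lambda>x. (snd x, area (snd x - fst x))) ` ({- U0..} \<times> {1..}) \<subseteq> region M e U0"
        using mem_region by auto
    qed
    then have "continuous_on ({- U0..} \<times> {1..})
        (\<lambda>x. area (snd x - fst x) * \<phi> (snd x, area (snd x - fst x)))"
      by (intro continuous_on_mult a)
    moreover have "(\<lambda>x. area (snd x - fst x) * \<phi> (snd x, area (snd x - fst x))) = (\<lambda>(u, v). \<psi> u v)"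
      by (simp add: psi f_def on_ext_def r_app fun_eq_iff)
    ultimately show ?thesis by (simp only:)
  qed
  have g0: "\<bar>d_v \<psi> (- U0) v\<bar> \<le> D / area (v + U0) ^ 3" if v: "1 \<le> v" for v
  proof -
    define r where "r = area (v + U0)"
    have r: "0 < r" "0 < lapse r" "lapse r < 1"
      using area_pos area_gt lapse_pos lapse_less_1 by (auto simp: r_def)
    have "r ^ 3 * \<bar>d_v \<psi> (- U0) v / lapse r\<bar> \<le> D"
      using assms(2) v by (auto simp: data_bounds_def \<psi>_def[symmetric] dv_r r_app r_def)
    then have "\<bar>d_v \<psi> (- U0) v\<bar> * r ^ 3 \<le> D * lapse r"
      using r by (simp add: field_simps)
    also have "\<dots> \<le> D * 1" using r assms by (intro mult_left_mono) auto
    finally show ?thesis using r unfolding r_def[symmetric] by (simp add: field_simps)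
  qed
  \<comment> \<open>The two data bounds on \<open>v = 1\<close> control \<open>k\<close> and
    \<open>f + r * k\<close>; together they control \<open>f\<close> itself without
    integration.\<close>
  have psi1: "\<bar>\<psi> u 1\<bar> \<le> D * area (1 - u) * (1 + area (1 - u))" if u: "- U0 \<le> u" for u
  proof -
    define r where "r = area (1 - u)"
    define k where "k = d_u {- U0..} f u 1 / - lapse r"
    have r: "0 < r" "0 < lapse r"
      using area_pos area_gt lapse_pos by (auto simp: r_def)
    have k: "\<bar>k\<bar> \<le> D"
      using assms(2) u by (auto simp: data_bounds_def f_def[symmetric] du_r r_def k_def)
    have "\<bar>d_u {- U0..} \<psi> u 1 / - lapse r\<bar> \<le> D"
      using assms(2) u by (auto simp: data_bounds_def \<psi>_def[symmetric] du_r r_def)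
    moreover have "d_u {- U0..} \<psi> u 1 / - lapse r = f u 1 + r * k"
      using r u by (simp add: du_psi k_def r_def[symmetric] field_simps)
    ultimately have "\<bar>f u 1 + r * k\<bar> \<le> D" by (simp only:)
    moreover have "\<bar>r * k\<bar> \<le> r * D" unfolding abs_mult using r k by (intro mult_mono) auto
    ultimately have "\<bar>f u 1\<bar> \<le> D * (1 + r)" by (simp add: algebra_simps)
    then have "r * \<bar>f u 1\<bar> \<le> r * (D * (1 + r))" using r by (intro mult_left_mono) auto
    then show ?thesis using r by (simp add: psi r_def[symmetric] abs_mult mult_ac)
  qed
  have "\<bar>\<psi> u v\<bar> \<le> R1 * A' / u ^ 3" if "1 \<le> u" "1 \<le> v" "area (v - u) = R1" for u v
  proof -
    have "u ^ 3 * \<bar>f u v\<bar> \<le> A'" using R1_decay that by (simp add: f_def r_ext_eq)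
    then have "R1 * (u ^ 3 * \<bar>f u v\<bar>) \<le> R1 * A'" using M_pos by (intro mult_left_mono) auto
    then show ?thesis using that M_pos by (simp add: psi abs_mult field_simps)
  qed
  then show ?thesis
    unfolding char_wave_def \<psi>_def[symmetric]
    using cont g_u g0 psi1 psi_v dv_psi by auto
qed

text \<open>Along the initial cone the radius is asymptotic to \<open>v\<close>, so the limit
  condition can be stated with \<open>v^3\<close>.\<close>

lemma tendsto_v_cubed:
  assumes "((\<lambda>v. area (v + U0) ^ 3 * f v) \<longlongrightarrow> l) at_top"
  shows "((\<lambda>v. v ^ 3 * f v) \<longlongrightarrow> l) at_top"
proof -
  have "filterlim (\<lambda>v. v + U0) at_top at_top" by real_asymp
  from filterlim_compose[OF area_asymp this]
  have "((\<lambda>v. (v + U0) / area (v + U0)) \<longlongrightarrow> 1) at_top" .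
  moreover have "((\<lambda>v. v / (v + U0)) \<longlongrightarrow> 1) at_top" by real_asymp
  ultimately have lim: "((\<lambda>v. (v / (v + U0) * ((v + U0) / area (v + U0))) ^ 3 * (area (v + U0) ^ 3 * f v))
      \<longlongrightarrow> (1 * 1) ^ 3 * l) at_top"
    by (intro tendsto_mult tendsto_power assms)
  have ev: "\<forall>\<^sub>F v in at_top. (v / (v + U0) * ((v + U0) / area (v + U0))) ^ 3 * (area (v + U0) ^ 3 * f v)
      = v ^ 3 * f v"
    using eventually_gt_at_top[of "- U0"]
  proof eventually_elim
    case (elim v)
    then show ?case using area_pos[of "v + U0"] by (simp add: power_divide)
  qed
  show ?thesis
    using Lim_transform_eventually[OF lim ev] by simp
qed

end

section \<open>The lower bound for solutions of the wave equation\<close>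

theorem theorem1p7:
  fixes M :: real
  assumes "0 < M"
  shows "\<exists>R1 > 2 * M. \<forall>e U0 D A' L :: real.
    0 < \<bar>e\<bar> \<and> \<bar>e\<bar> < M \<and> 0 < U0 \<and> 0 < D \<and> 0 < A' \<and> L \<noteq> 0 \<longrightarrow>
    (\<exists>R > R1. \<forall>f :: real \<Rightarrow> real. \<exists>U :: real. \<forall>\<phi> :: real \<times> real \<Rightarrow> real.
       wave_solution M e U0 \<phi> \<and>
       data_bounds M e U0 D \<phi> \<and>
       limit_condition M e U0 \<phi> \<and>
       (\<forall>v\<ge>1. d_v (rphi_ext M e \<phi>) (- U0) v = f v) \<and>
       (\<forall>u\<ge>1. \<forall>v\<ge>1. r_ext M e u v = R1 \<longrightarrow> u^3 * \<bar>on_ext M e \<phi> u v\<bar> \<le> A') \<and>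
       frakL M e U0 \<phi> = L \<longrightarrow>
       (\<forall>u\<ge>U. \<forall>v. r_ext M e u v = R \<longrightarrow>
          \<bar>d_v (rphi_ext M e \<phi>) u v\<bar> \<ge> \<bar>L\<bar> / 8 * v powi (- 3)))"
proof (rule exI[of _ "2048 * M"], intro conjI allI impI)
  show "2 * M < 2048 * M" using assms by simp
  fix e U0 D A' L :: real
  assume *: "0 < \<bar>e\<bar> \<and> \<bar>e\<bar> < M \<and> 0 < U0 \<and> 0 < D \<and> 0 < A' \<and> L \<noteq> 0"
  then interpret subextremal M e by unfold_locales auto
  have "\<exists>R>R1. \<forall>f l. ((\<lambda>v. v ^ 3 * f v) \<longlongrightarrow> l) at_top \<longrightarrow> (\<exists>U. \<forall>\<psi> g.
      char_wave U0 D (R1 * A') \<psi> g \<longrightarrow> (\<forall>v\<ge>1. g (- U0) v = f v) \<longrightarrow>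
      l - integral {- U0..} (\<lambda>u. 2 * M * rad \<psi> u) = L \<longrightarrow>
      (\<forall>u\<ge>U. \<forall>v. area (v - u) = R \<longrightarrow> 1 \<le> v \<and> \<bar>L\<bar> / 8 \<le> v ^ 3 * \<bar>g u v\<bar>))"
    using * M_pos by (intro char_wave_lower_bound) auto
  then obtain R where R: "R1 < R" and key: "\<And>f l. ((\<lambda>v. v ^ 3 * f v) \<longlongrightarrow> l) at_top \<Longrightarrow> \<exists>U. \<forall>\<psi> g.
      char_wave U0 D (R1 * A') \<psi> g \<longrightarrow> (\<forall>v\<ge>1. g (- U0) v = f v) \<longrightarrow>
      l - integral {- U0..} (\<lambda>u. 2 * M * rad \<psi> u) = L \<longrightarrow>
      (\<forall>u\<ge>U. \<forall>v. area (v - u) = R \<longrightarrow> 1 \<le> v \<and> \<bar>L\<bar> / 8 \<le> v ^ 3 * \<bar>g u v\<bar>)"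
    by blast
  have all: "\<forall>f :: real \<Rightarrow> real. \<exists>U. \<forall>\<phi>. wave_solution M e U0 \<phi> \<and> data_bounds M e U0 D \<phi> \<and> limit_condition M e U0 \<phi> \<and>
      (\<forall>v\<ge>1. d_v (rphi_ext M e \<phi>) (- U0) v = f v) \<and>
      (\<forall>u\<ge>1. \<forall>v\<ge>1. r_ext M e u v = R1 \<longrightarrow> u ^ 3 * \<bar>on_ext M e \<phi> u v\<bar> \<le> A') \<and>
      frakL M e U0 \<phi> = L \<longrightarrow>
      (\<forall>u\<ge>U. \<forall>v. r_ext M e u v = R \<longrightarrow>
        \<bar>d_v (rphi_ext M e \<phi>) u v\<bar> \<ge> \<bar>L\<bar> / 8 * v powi (- 3))" (is "\<forall>f. \<exists>U. \<forall>\<phi>. ?hyps f \<phi> \<longrightarrow> ?concl U \<phi>")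
  proof
    fix f :: "real \<Rightarrow> real"
    \<comment> \<open>The limit in the condition is a limit of \<open>v^3 * f v\<close>, so it
      depends on the prescribed initial values alone.\<close>
    have lim: "((\<lambda>v. v ^ 3 * f v) \<longlongrightarrow> l) at_top"
      and frakL: "frakL M e U0 \<phi> = l - integral {- U0..} (\<lambda>u. 2 * M * rad (rphi_ext M e \<phi>) u)"
      if h: "?hyps f \<phi>"
        and l: "((\<lambda>v. area (v + U0) ^ 3 * d_v (rphi_ext M e \<phi>) (- U0) v) \<longlongrightarrow> l) at_top" for \<phi> l
    proof -
      have ev: "\<forall>\<^sub>F v in at_top. v ^ 3 * d_v (rphi_ext M e \<phi>) (- U0) v = v ^ 3 * f v"
        using eventually_ge_at_top[of 1] by eventually_elim (use h in simp)
      show "((\<lambda>v. v ^ 3 * f v) \<longlongrightarrow> l) at_top"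
        using Lim_transform_eventually[OF tendsto_v_cubed[OF l] ev] .
      show "frakL M e U0 \<phi> = l - integral {- U0..} (\<lambda>u. 2 * M * rad (rphi_ext M e \<phi>) u)"
        using tendsto_Lim[OF _ l] by (simp add: frakL_def rad_field_def rad_def r_ext_eq)
    qed
    have lim_ex: "\<exists>l. ((\<lambda>v. area (v + U0) ^ 3 * d_v (rphi_ext M e \<phi>) (- U0) v) \<longlongrightarrow> l) at_top"
      if "?hyps f \<phi>" for \<phi>
      using that by (simp add: limit_condition_def r_ext_eq)
    show "\<exists>U. \<forall>\<phi>. ?hyps f \<phi> \<longrightarrow> ?concl U \<phi>"
    proof (cases "\<exists>l. ((\<lambda>v. v ^ 3 * f v) \<longlongrightarrow> l) at_top")
      \<comment> \<open>No solution with initial values \<open>f\<close> satisfies the limit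
        condition, so any \<open>U\<close> serves.\<close>
      case False
      have "\<not> ?hyps f \<phi>" for \<phi>
      proof
        assume h: "?hyps f \<phi>"
        from lim_ex[OF h] obtain l
          where "((\<lambda>v. area (v + U0) ^ 3 * d_v (rphi_ext M e \<phi>) (- U0) v) \<longlongrightarrow> l) at_top" ..
        from lim[OF h this] False show False by blast
      qed
      then show ?thesis by (intro exI allI impI) (rule notE)
    next
      case True
      then obtain l where l: "((\<lambda>v. v ^ 3 * f v) \<longlongrightarrow> l) at_top" by blast
      \<comment> \<open>\<open>U\<close> is fixed before the solution, so it depends on the latter
        only through \<open>f\<close>.\<close>
      from key[OF l] obtain U where U: "\<forall>\<psi> g. char_wave U0 D (R1 * A') \<psi> g \<longrightarrow>
          (\<forall>v\<ge>1. g (- U0) v = f v) \<longrightarrow> l - integral {- U0..} (\<lambda>u. 2 * M * rad \<psi> u) = L \<longrightarrow>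
          (\<forall>u\<ge>U. \<forall>v. area (v - u) = R \<longrightarrow> 1 \<le> v \<and> \<bar>L\<bar> / 8 \<le> v ^ 3 * \<bar>g u v\<bar>)" ..
      have "\<forall>\<phi>. ?hyps f \<phi> \<longrightarrow> ?concl U \<phi>"
      proof (rule allI, rule impI, intro allI impI)
        fix \<phi> u v assume h: "?hyps f \<phi>" and u: "U \<le> u" and v: "r_ext M e u v = R"
        obtain l' where l': "((\<lambda>v. area (v + U0) ^ 3 * d_v (rphi_ext M e \<phi>) (- U0) v) \<longlongrightarrow> l') at_top"
          using lim_ex[OF h] by blast
        \<comment> \<open>Uniqueness of limits identifies the limit of the particular solution with
          the one used to choose \<open>U\<close>.\<close>
        have "l = l'" using tendsto_unique[OF _ l lim[OF h l']] by simp
        then have L: "l - integral {- U0..} (\<lambda>u. 2 * M * rad (rphi_ext M e \<phi>) u) = L"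
          using frakL[OF h l'] h by simp
        have w: "char_wave U0 D (R1 * A') (rphi_ext M e \<phi>) (d_v (rphi_ext M e \<phi>))"
          using h * by (intro wave_solution_char_wave) auto
        have g: "\<forall>v\<ge>1. d_v (rphi_ext M e \<phi>) (- U0) v = f v" using h by (elim conjE)
        have "area (v - u) = R" using v by (simp add: r_ext_eq)
        with U[THEN spec, THEN spec, THEN mp, THEN mp, THEN mp, OF w g L] u
        \<comment> \<open>The inequality \<open>1 \<le> v\<close> comes from the choice of
          \<open>U\<close>; it permits division by \<open>v^3\<close>.\<close>
        have "1 \<le> v \<and> \<bar>L\<bar> / 8 \<le> v ^ 3 * \<bar>d_v (rphi_ext M e \<phi>) u v\<bar>" by simp
        then show "\<bar>L\<bar> / 8 * v powi (- 3) \<le> \<bar>d_v (rphi_ext M e \<phi>) u v\<bar>"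
          by (simp add: power_int_minus field_simps)
      qed
      then show ?thesis by (rule exI[of _ U])
    qed
  qed
  show "\<exists>R>R1. \<forall>f. \<exists>U. \<forall>\<phi>. wave_solution M e U0 \<phi> \<and> data_bounds M e U0 D \<phi> \<and>
      limit_condition M e U0 \<phi> \<and>
      (\<forall>v\<ge>1. d_v (rphi_ext M e \<phi>) (- U0) v = f v) \<and>
      (\<forall>u\<ge>1. \<forall>v\<ge>1. r_ext M e u v = R1 \<longrightarrow> u ^ 3 * \<bar>on_ext M e \<phi> u v\<bar> \<le> A') \<and>
      frakL M e U0 \<phi> = L \<longrightarrow>
      (\<forall>u\<ge>U. \<forall>v. r_ext M e u v = R \<longrightarrow>
        \<bar>d_v (rphi_ext M e \<phi>) u v\<bar> \<ge> \<bar>L\<bar> / 8 * v powi (- 3))"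
    by (rule exI[of _ R], rule conjI, rule R, rule all)
qed

end
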